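(* Let $\mathcal{Q}$ be a Dynkin quiver. The functor $\Lambda:\bmod\,k\mathcal{Q}\to\bmod\,\mathcal{H}_{\mathcal{Q}}^{\rm op}$, $M\mapsto\widehat{M}$, is fully faithful.
   Context: Let $k$ be a field, $\mathcal{Q}$ a Dynkin quiver (an orientation of a simply laced Dynkin diagram), $k\mathcal{Q}$ its path algebra, $\bmod\,k\mathcal{Q}$ the category of finite dimensional left $k\mathcal{Q}$-modules, identified with finite dimensional representations of $\mathcal{Q}$, and ${\rm proj}\,k\mathcal{Q}$ the full subcategory of projectives. ${\rm Hom}^{\rm mono}({\rm proj}\,k\mathcal{Q})$ is the category whose objects are injective maps $\iota:P\to Q$ between objects of ${\rm proj}\,k\mathcal{Q}$, with morphisms from $\iota:P\to Q$ to $\iota':P'\to Q'$ the pairs $(\varphi:P\to P',\psi:Q\to Q')$ with $\psi\iota=\iota'\varphi$. $\mathcal{H}_{\mathcal{Q}}$ is the full subcategory of objects without (nonzero) direct summands of the form $0\to P$. $\bmod\,\mathcal{H}_{\mathcal{Q}}^{\rm op}$ is the category of $k$-linear additive contravariant functors from $\mathcal{H}_{\mathcal{Q}}$ to finite dimensional $k$-vector spaces. For $M\in\bmod\,k\mathcal{Q}$, the functor $\widehat{M}$ is defined by $\widehat{M}(\iota:P\to Q)={\rm Im}\big({\rm Hom}(\iota,M):{\rm Hom}(Q,M)\to{\rm Hom}(P,M)\big)$, with the natural definition on morphisms; this is functorial in $M$ and defines $\Lambda$. *)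

theory Defs
  imports Main "HOL-Library.Function_Algebras" "HOL-Library.Product_Plus" "Graph_Theory.Digraph"
begin

section \<open>Subspaces of an ambient vector space\<close>

text \<open>
  All finite dimensional vector spaces are subspaces of an ambient \<^emph>\<open>universe\<close>, given by a type
  with a scalar multiplication \<open>s\<close> that satisfies \<^locale>\<open>vector_space\<close>. If the universe has
  infinite dimension, every finite dimensional space is isomorphic to one of its subspaces.
\<close>

definition fd_subspace :: "('k::field \<Rightarrow> 'u::ab_group_add \<Rightarrow> 'u) \<Rightarrow> 'u set \<Rightarrow> bool" where
  "fd_subspace s V \<longleftrightarrow>
     module.subspace s V \<and> (\<exists>B. finite B \<and> B \<subseteq> V \<and> V \<subseteq> module.span s B)"

text \<open>
  A linear map between two subspaces is represented by its extension by zero to the universe, so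
  that equality of linear maps is equality in HOL and sums of linear maps are pointwise sums.
\<close>

definition lin_maps ::
  "('k::field \<Rightarrow> 'u::ab_group_add \<Rightarrow> 'u) \<Rightarrow> ('k \<Rightarrow> 'w::ab_group_add \<Rightarrow> 'w) \<Rightarrow>
   'u set \<Rightarrow> 'w set \<Rightarrow> ('u \<Rightarrow> 'w) set" where
  "lin_maps s s' V W = {f.
     (\<forall>x\<in>V. f x \<in> W) \<and>
     (\<forall>x\<in>V. \<forall>y\<in>V. f (x + y) = f x + f y) \<and>
     (\<forall>c. \<forall>x\<in>V. f (s c x) = s' c (f x)) \<and>
     (\<forall>x. x \<notin> V \<longrightarrow> f x = 0)}"

definition id_map :: "'u::zero set \<Rightarrow> 'u \<Rightarrow> 'u" where
  "id_map V x = (if x \<in> V then x else 0)"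

section \<open>Categories\<close>

text \<open>
  Composition does not mention domains and codomains, so hom sets need not be disjoint; this is why
  the maps on morphisms below take the domain and codomain as additional arguments.
\<close>

record ('o, 'm) cat =
  obj :: "'o set"
  hom :: "'o \<Rightarrow> 'o \<Rightarrow> 'm set"
  idt :: "'o \<Rightarrow> 'm"
  cmp :: "'m \<Rightarrow> 'm \<Rightarrow> 'm"

definition category :: "('o, 'm) cat \<Rightarrow> bool" where
  "category C \<longleftrightarrow>
     (\<forall>X\<in>obj C. idt C X \<in> hom C X X) \<and>
     (\<forall>X\<in>obj C. \<forall>Y\<in>obj C. \<forall>Z\<in>obj C. \<forall>f\<in>hom C X Y. \<forall>g\<in>hom C Y Z. cmp C g f \<in> hom C X Z) \<and>
     (\<forall>X\<in>obj C. \<forall>Y\<in>obj C. \<forall>f\<in>hom C X Y. cmp C f (idt C X) = f \<and> cmp C (idt C Y) f = f) \<and>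
     (\<forall>X\<in>obj C. \<forall>Y\<in>obj C. \<forall>Z\<in>obj C. \<forall>U\<in>obj C.
        \<forall>f\<in>hom C X Y. \<forall>g\<in>hom C Y Z. \<forall>h\<in>hom C Z U. cmp C h (cmp C g f) = cmp C (cmp C h g) f)"

definition is_functor ::
  "('o, 'm) cat \<Rightarrow> ('p, 'n) cat \<Rightarrow> ('o \<Rightarrow> 'p) \<Rightarrow> ('o \<Rightarrow> 'o \<Rightarrow> 'm \<Rightarrow> 'n) \<Rightarrow> bool" where
  "is_functor C D F0 F1 \<longleftrightarrow> category C \<and> category D \<and>
     (\<forall>X\<in>obj C. F0 X \<in> obj D) \<and>
     (\<forall>X\<in>obj C. \<forall>Y\<in>obj C. \<forall>f\<in>hom C X Y. F1 X Y f \<in> hom D (F0 X) (F0 Y)) \<and>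
     (\<forall>X\<in>obj C. F1 X X (idt C X) = idt D (F0 X)) \<and>
     (\<forall>X\<in>obj C. \<forall>Y\<in>obj C. \<forall>Z\<in>obj C. \<forall>f\<in>hom C X Y. \<forall>g\<in>hom C Y Z.
        F1 X Z (cmp C g f) = cmp D (F1 Y Z g) (F1 X Y f))"

definition fully_faithful ::
  "('o, 'm) cat \<Rightarrow> ('p, 'n) cat \<Rightarrow> ('o \<Rightarrow> 'p) \<Rightarrow> ('o \<Rightarrow> 'o \<Rightarrow> 'm \<Rightarrow> 'n) \<Rightarrow> bool" where
  "fully_faithful C D F0 F1 \<longleftrightarrow>
     (\<forall>X\<in>obj C. \<forall>Y\<in>obj C. bij_betw (F1 X Y) (hom C X Y) (hom D (F0 X) (F0 Y)))"

text \<open>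
  \<open>X\<close> is a biproduct of \<open>Y\<close> and \<open>Z\<close>. The hom sets are understood to be subgroups of the
  type of morphisms, whose addition is used here.
\<close>

definition biproduct :: "('o, 'm::ab_group_add) cat \<Rightarrow> 'o \<Rightarrow> 'o \<Rightarrow> 'o \<Rightarrow> bool" where
  "biproduct C X Y Z \<longleftrightarrow>
     (\<exists>i\<in>hom C Y X. \<exists>p\<in>hom C X Y. \<exists>j\<in>hom C Z X. \<exists>q\<in>hom C X Z.
        cmp C p i = idt C Y \<and> cmp C q j = idt C Z \<and> cmp C p j = 0 \<and> cmp C q i = 0 \<and>
        cmp C i p + cmp C j q = idt C X)"

definition direct_summand :: "('o, 'm::ab_group_add) cat \<Rightarrow> 'o \<Rightarrow> 'o \<Rightarrow> bool" where
  "direct_summand C Y X \<longleftrightarrow> Y \<in> obj C \<and> (\<exists>Z\<in>obj C. biproduct C X Y Z)"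

section \<open>Dynkin quivers\<close>

definition path_edges :: "nat \<Rightarrow> nat set set" where
  "path_edges m = {{i, Suc i} | i. Suc i < m}"

text \<open>Edge sets of the simply laced Dynkin diagrams on the vertices \<open>0, \<dots>, n - 1\<close>.\<close>

inductive simply_laced_dynkin :: "nat \<Rightarrow> nat set set \<Rightarrow> bool" where
  type_A: "n \<ge> 1 \<Longrightarrow> simply_laced_dynkin n (path_edges n)"
| type_D: "n \<ge> 4 \<Longrightarrow> simply_laced_dynkin n (insert {n - 3, n - 1} (path_edges (n - 1)))"
| type_E: "n \<in> {6, 7, 8} \<Longrightarrow> simply_laced_dynkin n (insert {2, n - 1} (path_edges (n - 1)))"

definition dynkin_quiver :: "('v, 'a) pre_digraph \<Rightarrow> bool" where
  "dynkin_quiver Q \<longleftrightarrow> wf_digraph Q \<and>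
     (\<exists>n E \<phi>. simply_laced_dynkin n E \<and> bij_betw \<phi> (verts Q) {..<n} \<and>
        bij_betw (\<lambda>a. {\<phi> (tail Q a), \<phi> (head Q a)}) (arcs Q) E)"

section \<open>Representations\<close>

text \<open>
  Finite dimensional left modules over the path algebra, as representations of the quiver. The
  values of \<open>space\<close> and \<open>arr\<close> outside the vertices and arcs of the quiver play no role.
\<close>

record ('v, 'a, 'u) rep =
  space :: "'v \<Rightarrow> 'u set"
  arr :: "'a \<Rightarrow> 'u \<Rightarrow> 'u"

type_synonym ('v, 'u) rep_mor = "'v \<Rightarrow> 'u \<Rightarrow> 'u"

definition is_rep ::
  "('k::field \<Rightarrow> 'u::ab_group_add \<Rightarrow> 'u) \<Rightarrow> ('v, 'a) pre_digraph \<Rightarrow> ('v, 'a, 'u) rep \<Rightarrow> bool" where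
  "is_rep s Q M \<longleftrightarrow>
     (\<forall>v\<in>verts Q. fd_subspace s (space M v)) \<and>
     (\<forall>a\<in>arcs Q. arr M a \<in> lin_maps s s (space M (tail Q a)) (space M (head Q a)))"

definition rep_hom ::
  "('k::field \<Rightarrow> 'u::ab_group_add \<Rightarrow> 'u) \<Rightarrow> ('v, 'a) pre_digraph \<Rightarrow>
   ('v, 'a, 'u) rep \<Rightarrow> ('v, 'a, 'u) rep \<Rightarrow> ('v, 'u) rep_mor set" where
  "rep_hom s Q M N = {f.
     (\<forall>v\<in>verts Q. f v \<in> lin_maps s s (space M v) (space N v)) \<and>
     (\<forall>v. v \<notin> verts Q \<longrightarrow> f v = 0) \<and>
     (\<forall>a\<in>arcs Q. \<forall>x\<in>space M (tail Q a).
        f (head Q a) (arr M a x) = arr N a (f (tail Q a) x))}"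

definition rep_id ::
  "('v, 'a) pre_digraph \<Rightarrow> ('v, 'a, 'u::ab_group_add) rep \<Rightarrow> ('v, 'u) rep_mor" where
  "rep_id Q M v = (if v \<in> verts Q then id_map (space M v) else 0)"

definition rep_comp :: "('v, 'u) rep_mor \<Rightarrow> ('v, 'u) rep_mor \<Rightarrow> ('v, 'u) rep_mor" where
  "rep_comp g f v = g v \<circ> f v"

definition mod_kQ ::
  "('k::field \<Rightarrow> 'u::ab_group_add \<Rightarrow> 'u) \<Rightarrow> ('v, 'a) pre_digraph \<Rightarrow>
   (('v, 'a, 'u) rep, ('v, 'u) rep_mor) cat" where
  "mod_kQ s Q = \<lparr>obj = {M. is_rep s Q M}, hom = rep_hom s Q, idt = rep_id Q, cmp = rep_comp\<rparr>"

definition zero_rep :: "('v, 'a) pre_digraph \<Rightarrow> ('v, 'a, 'u::zero) rep \<Rightarrow> bool" where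
  "zero_rep Q M \<longleftrightarrow> (\<forall>v\<in>verts Q. space M v = {0})"

definition rep_inj ::
  "('v, 'a) pre_digraph \<Rightarrow> ('v, 'a, 'u) rep \<Rightarrow> ('v, 'u) rep_mor \<Rightarrow> bool" where
  "rep_inj Q M f \<longleftrightarrow> (\<forall>v\<in>verts Q. inj_on (f v) (space M v))"

definition rep_surj ::
  "('v, 'a) pre_digraph \<Rightarrow> ('v, 'a, 'u) rep \<Rightarrow> ('v, 'a, 'u) rep \<Rightarrow> ('v, 'u) rep_mor \<Rightarrow> bool" where
  "rep_surj Q M N f \<longleftrightarrow> (\<forall>v\<in>verts Q. f v ` space M v = space N v)"

definition projective_rep ::
  "('k::field \<Rightarrow> 'u::ab_group_add \<Rightarrow> 'u) \<Rightarrow> ('v, 'a) pre_digraph \<Rightarrow> ('v, 'a, 'u) rep \<Rightarrow> bool" where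
  "projective_rep s Q P \<longleftrightarrow> is_rep s Q P \<and>
     (\<forall>M N. is_rep s Q M \<longrightarrow> is_rep s Q N \<longrightarrow>
        (\<forall>g\<in>rep_hom s Q M N. \<forall>f\<in>rep_hom s Q P N. rep_surj Q M N g \<longrightarrow>
           (\<exists>h\<in>rep_hom s Q P M. rep_comp g h = f)))"

section \<open>Injective maps of projectives\<close>

record ('v, 'a, 'u) mono_obj =
  src :: "('v, 'a, 'u) rep"
  tgt :: "('v, 'a, 'u) rep"
  incl :: "('v, 'u) rep_mor"

type_synonym ('v, 'u) mono_mor = "('v, 'u) rep_mor \<times> ('v, 'u) rep_mor"

definition hom_mono ::
  "('k::field \<Rightarrow> 'u::ab_group_add \<Rightarrow> 'u) \<Rightarrow> ('v, 'a) pre_digraph \<Rightarrow>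
   (('v, 'a, 'u) mono_obj, ('v, 'u) mono_mor) cat" where
  "hom_mono s Q = \<lparr>
     obj = {X. projective_rep s Q (src X) \<and> projective_rep s Q (tgt X) \<and>
               incl X \<in> rep_hom s Q (src X) (tgt X) \<and> rep_inj Q (src X) (incl X)},
     hom = (\<lambda>X Y. {(\<phi>, \<psi>). \<phi> \<in> rep_hom s Q (src X) (src Y) \<and> \<psi> \<in> rep_hom s Q (tgt X) (tgt Y) \<and>
               rep_comp \<psi> (incl X) = rep_comp (incl Y) \<phi>}),
     idt = (\<lambda>X. (rep_id Q (src X), rep_id Q (tgt X))),
     cmp = (\<lambda>(\<phi>', \<psi>') (\<phi>, \<psi>). (rep_comp \<phi>' \<phi>, rep_comp \<psi>' \<psi>))\<rparr>"

definition H_cat ::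
  "('k::field \<Rightarrow> 'u::ab_group_add \<Rightarrow> 'u) \<Rightarrow> ('v, 'a) pre_digraph \<Rightarrow>
   (('v, 'a, 'u) mono_obj, ('v, 'u) mono_mor) cat" where
  "H_cat s Q = (hom_mono s Q)\<lparr>obj := {X \<in> obj (hom_mono s Q).
     \<forall>Y. direct_summand (hom_mono s Q) Y X \<longrightarrow> zero_rep Q (src Y) \<longrightarrow> zero_rep Q (tgt Y)}\<rparr>"

section \<open>Contravariant functors to vector spaces\<close>

definition rep_mor_scale ::
  "('k \<Rightarrow> 'u \<Rightarrow> 'u) \<Rightarrow> 'k \<Rightarrow> ('v, 'u) rep_mor \<Rightarrow> ('v, 'u) rep_mor" where
  "rep_mor_scale s c f = (\<lambda>v x. s c (f v x))"

definition mono_mor_scale ::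
  "('k \<Rightarrow> 'u \<Rightarrow> 'u) \<Rightarrow> 'k \<Rightarrow> ('v, 'u) mono_mor \<Rightarrow> ('v, 'u) mono_mor" where
  "mono_mor_scale s c = map_prod (rep_mor_scale s c) (rep_mor_scale s c)"

record ('o, 'm, 'w) contra_functor =
  fobj :: "'o \<Rightarrow> 'w set"
  fmor :: "'o \<Rightarrow> 'o \<Rightarrow> 'm \<Rightarrow> 'w \<Rightarrow> 'w"

text \<open>
  Here \<open>sm\<close> is the scalar multiplication on morphisms of the source category \<open>C\<close>, and \<open>sw\<close> that
  of the universe of the values. Additivity of the functor is additivity on hom spaces.
\<close>

definition cat_module ::
  "('k::field \<Rightarrow> 'm::ab_group_add \<Rightarrow> 'm) \<Rightarrow> ('o, 'm) cat \<Rightarrow> ('k \<Rightarrow> 'w::ab_group_add \<Rightarrow> 'w) \<Rightarrow>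
   ('o, 'm, 'w) contra_functor \<Rightarrow> bool" where
  "cat_module sm C sw F \<longleftrightarrow>
     (\<forall>X\<in>obj C. fd_subspace sw (fobj F X)) \<and>
     (\<forall>X\<in>obj C. \<forall>Y\<in>obj C. \<forall>f\<in>hom C X Y. fmor F X Y f \<in> lin_maps sw sw (fobj F Y) (fobj F X)) \<and>
     (\<forall>X\<in>obj C. fmor F X X (idt C X) = id_map (fobj F X)) \<and>
     (\<forall>X\<in>obj C. \<forall>Y\<in>obj C. \<forall>Z\<in>obj C. \<forall>f\<in>hom C X Y. \<forall>g\<in>hom C Y Z.
        fmor F X Z (cmp C g f) = fmor F X Y f \<circ> fmor F Y Z g) \<and>
     (\<forall>X\<in>obj C. \<forall>Y\<in>obj C. \<forall>f\<in>hom C X Y. \<forall>g\<in>hom C X Y.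
        fmor F X Y (f + g) = fmor F X Y f + fmor F X Y g) \<and>
     (\<forall>X\<in>obj C. \<forall>Y\<in>obj C. \<forall>f\<in>hom C X Y. \<forall>c.
        fmor F X Y (sm c f) = (\<lambda>x. sw c (fmor F X Y f x)))"

definition nat_trans ::
  "('o, 'm) cat \<Rightarrow> ('k::field \<Rightarrow> 'w::ab_group_add \<Rightarrow> 'w) \<Rightarrow>
   ('o, 'm, 'w) contra_functor \<Rightarrow> ('o, 'm, 'w) contra_functor \<Rightarrow> ('o \<Rightarrow> 'w \<Rightarrow> 'w) set" where
  "nat_trans C sw F G = {\<eta>.
     (\<forall>X\<in>obj C. \<eta> X \<in> lin_maps sw sw (fobj F X) (fobj G X)) \<and>
     (\<forall>X. X \<notin> obj C \<longrightarrow> \<eta> X = 0) \<and>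
     (\<forall>X\<in>obj C. \<forall>Y\<in>obj C. \<forall>f\<in>hom C X Y. \<eta> X \<circ> fmor F X Y f = fmor G X Y f \<circ> \<eta> Y)}"

definition cat_modules ::
  "('k::field \<Rightarrow> 'm::ab_group_add \<Rightarrow> 'm) \<Rightarrow> ('o, 'm) cat \<Rightarrow> ('k \<Rightarrow> 'w::ab_group_add \<Rightarrow> 'w) \<Rightarrow>
   (('o, 'm, 'w) contra_functor, 'o \<Rightarrow> 'w \<Rightarrow> 'w) cat" where
  "cat_modules sm C sw = \<lparr>
     obj = {F. cat_module sm C sw F},
     hom = nat_trans C sw,
     idt = (\<lambda>F X. if X \<in> obj C then id_map (fobj F X) else 0),
     cmp = (\<lambda>\<theta> \<eta> X. \<theta> X \<circ> \<eta> X)\<rparr>"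

text \<open>The values of the functors are subspaces of the space of families of maps, which
  contains all spaces \<^const>\<open>rep_hom\<close>.\<close>

definition mod_Hop ::
  "('k::field \<Rightarrow> 'u::ab_group_add \<Rightarrow> 'u) \<Rightarrow> ('v, 'a) pre_digraph \<Rightarrow>
   ((('v, 'a, 'u) mono_obj, ('v, 'u) mono_mor, ('v, 'u) rep_mor) contra_functor,
    ('v, 'a, 'u) mono_obj \<Rightarrow> ('v, 'u) rep_mor \<Rightarrow> ('v, 'u) rep_mor) cat" where
  "mod_Hop s Q = cat_modules (mono_mor_scale s) (H_cat s Q) (rep_mor_scale s)"

section \<open>The functor \<open>\<Lambda>\<close>\<close>

text \<open>
  On objects, the image of the map \<open>g \<mapsto> g \<circ> \<iota>\<close> from \<open>Hom(Q, M)\<close> to \<open>Hom(P, M)\<close>; on a morphism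
  \<open>(\<phi>, \<psi>)\<close> from \<open>\<iota>\<close> to \<open>\<iota>'\<close>, the map \<open>h \<mapsto> h \<circ> \<phi>\<close>, a restriction of \<open>Hom(\<phi>, M)\<close>.
\<close>

definition hat_obj ::
  "('k::field \<Rightarrow> 'u::ab_group_add \<Rightarrow> 'u) \<Rightarrow> ('v, 'a) pre_digraph \<Rightarrow> ('v, 'a, 'u) rep \<Rightarrow>
   ('v, 'a, 'u) mono_obj \<Rightarrow> ('v, 'u) rep_mor set" where
  "hat_obj s Q M X = (\<lambda>g. rep_comp g (incl X)) ` rep_hom s Q (tgt X) M"

definition Lambda_obj ::
  "('k::field \<Rightarrow> 'u::ab_group_add \<Rightarrow> 'u) \<Rightarrow> ('v, 'a) pre_digraph \<Rightarrow> ('v, 'a, 'u) rep \<Rightarrow>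
   (('v, 'a, 'u) mono_obj, ('v, 'u) mono_mor, ('v, 'u) rep_mor) contra_functor" where
  "Lambda_obj s Q M = \<lparr>
     fobj = hat_obj s Q M,
     fmor = (\<lambda>X Y (\<phi>, \<psi>) h. if h \<in> hat_obj s Q M Y then rep_comp h \<phi> else 0)\<rparr>"

definition Lambda_mor ::
  "('k::field \<Rightarrow> 'u::ab_group_add \<Rightarrow> 'u) \<Rightarrow> ('v, 'a) pre_digraph \<Rightarrow>
   ('v, 'a, 'u) rep \<Rightarrow> ('v, 'a, 'u) rep \<Rightarrow> ('v, 'u) rep_mor \<Rightarrow>
   ('v, 'a, 'u) mono_obj \<Rightarrow> ('v, 'u) rep_mor \<Rightarrow> ('v, 'u) rep_mor" where
  "Lambda_mor s Q M N f = (\<lambda>X h.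
     if X \<in> obj (H_cat s Q) \<and> h \<in> hat_obj s Q M X then rep_comp f h else 0)"

end

theory Submission
  imports Defs
begin

text \<open>
  For the identity \<open>id\<^sub>P\<close> of a projective \<open>P\<close> one has \<open>\<Lambda>(M)(id\<^sub>P) = Hom(P, M)\<close>, and \<open>id\<^sub>P\<close> has no
  nonzero direct summand \<open>0 \<rightarrow> R\<close> (\<open>zero_summand_id_obj\<close>), so it is an object of the source
  category \<open>\<H>\<close> of \<open>\<Lambda>(M)\<close>. Hence, restricted to identities, \<open>\<Lambda>\<close> is the Yoneda embedding along the
  projectives. Let \<open>P\<^sub>v\<close> be the projective generated by a vertex \<open>v\<close>, so that \<open>Hom(P\<^sub>v, M) = M\<^sub>v\<close> by
  evaluation at the generator. A natural transformation \<open>\<eta> : \<Lambda>(M) \<rightarrow> \<Lambda>(N)\<close> then induces maps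
  \<open>f\<^sub>v : M\<^sub>v \<rightarrow> N\<^sub>v\<close>, and they form a morphism \<open>f\<close>.

  The values of \<open>\<eta>\<close> at the other objects \<open>\<iota> : P \<rightarrow> P'\<close> are forced by these. An element \<open>x\<close> of the
  space of \<open>P\<close> at \<open>v\<close> is the image of the generator under a morphism \<open>\<rho> : P\<^sub>v \<rightarrow> P\<close>, and \<open>(\<rho>, \<iota>\<rho>)\<close> is
  a morphism in \<open>\<H>\<close> from the identity of \<open>P\<^sub>v\<close> to \<open>\<iota>\<close>. Naturality along it says that \<open>\<eta>\<^sub>\<iota>(h)\<close> and
  \<open>f \<circ> h\<close> agree on \<open>x\<close> (\<open>full_Lambda\<close>). Faithfulness is read off at the identities alone
  (\<open>faithful_Lambda\<close>).

  The shape of the quiver enters in the construction of \<open>P\<^sub>v\<close> as a finite dimensional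
  representation. A Dynkin diagram is a tree (\<open>dynkin_quiver_oriented_tree\<close>), so there is at most
  one directed path from \<open>v\<close> to any vertex, and \<open>P\<^sub>v\<close> has a line at each vertex that can be reached
  from \<open>v\<close> and zero elsewhere. All these lines may be the span of one nonzero vector \<open>e\<close> of the
  universe. The uniqueness of paths is used in the form of
  \<open>oriented_tree_propagate\<close>, and gives \<open>hom_thin_proj_exists\<close> and \<open>projective_thin_proj\<close>.

  That \<open>\<Lambda>\<close> takes values in functors to finite dimensional spaces rests on the finite dimension of
  spaces of morphisms of representations (\<open>rep_hom_finitely_spanned\<close>).
\<close>

section \<open>Linear maps between subspaces\<close>

lemma lin_maps_mem: "f \<in> lin_maps s s' V W \<Longrightarrow> x \<in> V \<Longrightarrow> f x \<in> W"
  by (simp add: lin_maps_def)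

lemma lin_maps_add: "f \<in> lin_maps s s' V W \<Longrightarrow> x \<in> V \<Longrightarrow> y \<in> V \<Longrightarrow> f (x + y) = f x + f y"
  by (simp add: lin_maps_def)

lemma lin_maps_scale: "f \<in> lin_maps s s' V W \<Longrightarrow> x \<in> V \<Longrightarrow> f (s c x) = s' c (f x)"
  by (simp add: lin_maps_def)

lemma lin_maps_outside: "f \<in> lin_maps s s' V W \<Longrightarrow> x \<notin> V \<Longrightarrow> f x = 0"
  by (simp add: lin_maps_def)

lemma lin_maps_zero: "f \<in> lin_maps s s' V W \<Longrightarrow> f 0 = 0"
  using lin_maps_add[of f s s' V W 0 0] lin_maps_outside[of f s s' V W 0] by (cases "0 \<in> V") auto

lemma lin_maps_comp:
  assumes f: "f \<in> lin_maps s s' V W" and g: "g \<in> lin_maps s' s'' W U"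
  shows "g \<circ> f \<in> lin_maps s s'' V U"
  using lin_maps_mem[OF f] lin_maps_mem[OF g] lin_maps_add[OF f] lin_maps_add[OF g]
    lin_maps_scale[OF f] lin_maps_scale[OF g] lin_maps_outside[OF f] lin_maps_zero[OF g]
  unfolding lin_maps_def[of s s''] by simp

lemma lin_maps_id_right: "f \<in> lin_maps s s' V W \<Longrightarrow> f \<circ> id_map V = f"
  by (auto simp: fun_eq_iff id_map_def lin_maps_zero lin_maps_outside)

lemma lin_maps_id_left: "f \<in> lin_maps s s' V W \<Longrightarrow> id_map W \<circ> f = f"
  by (auto simp: fun_eq_iff id_map_def dest: lin_maps_mem)
    (metis lin_maps_mem lin_maps_outside)

context vector_space
begin

lemma id_map_in_lin_maps: "subspace V \<Longrightarrow> id_map V \<in> lin_maps scale scale V V"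
  by (auto simp: lin_maps_def id_map_def subspace_add subspace_scale)

lemma lin_maps_sum:
  assumes f: "f \<in> lin_maps scale s' V W" and "subspace V" and "\<And>i. i \<in> I \<Longrightarrow> x i \<in> V"
  shows "f (\<Sum>i\<in>I. x i) = (\<Sum>i\<in>I. f (x i))"
  using assms(3)
proof (induction I rule: infinite_finite_induct)
  case (insert i I)
  then have "(\<Sum>i\<in>I. x i) \<in> V" using \<open>subspace V\<close> by (simp add: subspace_sum)
  with insert show ?case by (simp add: lin_maps_add[OF f])
qed (simp_all add: lin_maps_zero[OF f])

lemma fd_subspace_basis:
  assumes "fd_subspace scale V"
  obtains B where "finite B" "independent B" "B \<subseteq> V" "V = span B"
proof -
  obtain T where T: "subspace V" "finite T" "V \<subseteq> span T"
    using assms by (auto simp: fd_subspace_def)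
  obtain B where B: "B \<subseteq> V" "independent B" "V \<subseteq> span B"
    using maximal_independent_subset .
  have "finite B" using independent_span_bound[of T B] T B by blast
  moreover have "V = span B" using B T by (simp add: span_minimal subset_antisym)
  ultimately show ?thesis using that B by blast
qed

text \<open>
  The spanning set may lie outside \<open>V\<close>: a basis of \<open>V\<close> is an independent subset of the span of \<open>T\<close>
  and hence finite.
\<close>

lemma fd_subspaceI:
  assumes "subspace V" "finite T" "V \<subseteq> span T"
  shows "fd_subspace scale V"
proof -
  obtain B where B: "B \<subseteq> V" "independent B" "V \<subseteq> span B"
    using maximal_independent_subset .
  have "finite B" using independent_span_bound[of T B] assms B by blast
  with B \<open>subspace V\<close> show ?thesis by (auto simp: fd_subspace_def)
qed

end

section \<open>Orientations of trees\<close>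

text \<open>
  The underlying graph is a tree, built by attaching leaves. The arc of a new leaf \<open>l\<close> may point
  to it or away from it.
\<close>

inductive oriented_tree :: "('a \<Rightarrow> 'v) \<Rightarrow> ('a \<Rightarrow> 'v) \<Rightarrow> 'v set \<Rightarrow> 'a set \<Rightarrow> bool"
  for t h :: "'a \<Rightarrow> 'v" where
  single: "oriented_tree t h {r} {}"
| leaf: "oriented_tree t h V A \<Longrightarrow> p \<in> V \<Longrightarrow> l \<notin> V \<Longrightarrow> a \<notin> A \<Longrightarrow> {t a, h a} = {p, l} \<Longrightarrow>
    oriented_tree t h (insert l V) (insert a A)"

text \<open>
  A graph on \<open>{..<n}\<close> in which every \<open>j \<ge> 1\<close> is joined to exactly one smaller vertex is a tree: the
  vertices are leaves when they are attached in increasing order. So the induction removes the vertex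
  numbered \<open>n\<close> together with its arc to the parent.
\<close>

lemma oriented_tree_parent:
  fixes n :: nat and \<phi> :: "'v \<Rightarrow> nat"
  assumes "n \<ge> 1" "bij_betw \<phi> V {..<n}" "\<And>a. a \<in> A \<Longrightarrow> t a \<in> V \<and> h a \<in> V"
    and "bij_betw (\<lambda>a. {\<phi> (t a), \<phi> (h a)}) A ((\<lambda>j. {p j, j}) ` {1..<n})"
    and p: "\<And>j. 1 \<le> j \<Longrightarrow> j < n \<Longrightarrow> p j < j"
  shows "oriented_tree t h V A"
  using assms
proof (induction n arbitrary: V A rule: nat_induct_at_least)
  case base
  then obtain r where "V = {r}"
    using bij_betw_same_card[OF base(1)] by (auto simp: card_1_singleton_iff)
  moreover have "A = {}" using base(3) by (simp add: bij_betw_def)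
  ultimately show ?case by (simp add: oriented_tree.single)
next
  case (Suc n)
  let ?e = "\<lambda>a. {\<phi> (t a), \<phi> (h a)}"
  have inj: "inj_on \<phi> V" and im: "\<phi> ` V = {..<Suc n}"
    using Suc.prems(1) by (auto simp: bij_betw_def)
  have injA: "inj_on ?e A" and imA: "?e ` A = (\<lambda>j. {p j, j}) ` {1..<Suc n}"
    using Suc.prems(3) by (auto simp: bij_betw_def)
  have pn: "p n < n" using Suc.prems(4)[of n] Suc.hyps by simp
  obtain l where l: "l \<in> V" "\<phi> l = n" using im by (metis imageE lessThan_iff lessI)
  obtain x where x: "x \<in> V" "\<phi> x = p n"
    using im pn by (metis imageE lessThan_iff less_SucI)
  have "{p n, n} \<in> ?e ` A" unfolding imA using Suc.hyps by auto
  then obtain a where a: "a \<in> A" "?e a = {p n, n}" by auto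
  have bijA: "bij_betw ?e (A - {a}) ((\<lambda>j. {p j, j}) ` {1..<n})"
  proof -
    have "?e ` (A - {a}) = ?e ` A - {?e a}"
      using inj_on_image_set_diff[OF injA, of A "{a}"] a by auto
    also have "\<dots> = (\<lambda>j. {p j, j}) ` {1..<n}"
    proof -
      have "{p j, j} \<noteq> {p n, n}" if "j \<ge> 1" "j < n" for j
        using Suc.prems(4)[of j] that by (auto simp: doubleton_eq_iff)
      moreover have "{1..<Suc n} = insert n {1..<n}" using Suc.hyps by auto
      ultimately show ?thesis unfolding imA a(2) by auto
    qed
    finally show ?thesis using injA by (auto simp: bij_betw_def intro: inj_on_subset)
  qed
  have ends: "t b \<in> V - {l} \<and> h b \<in> V - {l}" if b: "b \<in> A - {a}" for b
  proof -
    have "?e b \<in> (\<lambda>j. {p j, j}) ` {1..<n}" using bijA b by (auto simp: bij_betw_def)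
    then obtain j where "1 \<le> j" "j < n" "?e b = {p j, j}" by auto
    then have "n \<notin> ?e b" using Suc.prems(4)[of j] by auto
    then show ?thesis using Suc.prems(2)[of b] b l by auto
  qed
  have "oriented_tree t h (V - {l}) (A - {a})"
  proof (rule Suc.IH)
    have "\<phi> ` (V - {l}) = {..<n}"
      using inj_on_image_set_diff[OF inj, of V "{l}"] im l by auto
    then show "bij_betw \<phi> (V - {l}) {..<n}"
      using inj by (auto simp: bij_betw_def intro: inj_on_subset)
  qed (use ends bijA Suc.prems(4) in auto)
  moreover have "{t a, h a} = {x, l}"
  proof (rule inj_on_image_eq_iff[OF inj, THEN iffD1])
    show "\<phi> ` {t a, h a} = \<phi> ` {x, l}" using a x l by auto
  qed (use Suc.prems(2)[OF a(1)] x l in auto)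
  moreover have "x \<noteq> l" using x l pn by auto
  ultimately have "oriented_tree t h (insert l (V - {l})) (insert a (A - {a}))"
    using x by (intro oriented_tree.leaf) auto
  then show ?case using l a by (simp add: insert_absorb)
qed

lemma simply_laced_dynkin_parent:
  assumes "simply_laced_dynkin n E"
  shows "n \<ge> 1 \<and> (\<exists>p. (\<forall>j. 1 \<le> j \<longrightarrow> j < n \<longrightarrow> p j < j) \<and> E = (\<lambda>j. {p j, j}) ` {1..<n})"
proof -
  have path: "path_edges m = (\<lambda>j. {j - 1, j}) ` {1..<m}" for m
  proof -
    have "{i, Suc i} \<in> (\<lambda>j. {j - 1, j}) ` {1..<m}" if "Suc i < m" for i
      using that by (intro image_eqI[of _ _ "Suc i"]) auto
    moreover have "{j - 1, j} \<in> path_edges m" if "j \<in> {1..<m}" for j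
      using that by (auto simp: path_edges_def intro!: exI[of _ "j - 1"])
    ultimately show ?thesis by (auto simp: path_edges_def)
  qed
  have fork: "\<exists>p. (\<forall>j. 1 \<le> j \<longrightarrow> j < n \<longrightarrow> p j < j) \<and>
      insert {c, n - 1} (path_edges (n - 1)) = (\<lambda>j. {p j, j}) ` {1..<n}"
    if "c < n - 1" for c
  proof (intro exI[of _ "\<lambda>j. if j = n - 1 then c else j - 1"] conjI)
    have "{1..<n} = insert (n - 1) {1..<n - 1}" using that by auto
    then show "insert {c, n - 1} (path_edges (n - 1)) =
        (\<lambda>j. {if j = n - 1 then c else j - 1, j}) ` {1..<n}"
      unfolding path by auto
  qed (use that in auto)
  from assms show ?thesis
  proof cases
    case type_A
    then show ?thesis using path[of n] by (auto intro!: exI[of _ "\<lambda>j. j - 1"])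
  next
    case type_D
    then show ?thesis using fork[of "n - 3"] by auto
  next
    case type_E
    then show ?thesis using fork[of 2] by auto
  qed
qed

text \<open>
  The numbering of the vertices in the Dynkin diagrams makes each of them a rooted tree with root \<open>0\<close>:
  along the path the parent of \<open>j\<close> is \<open>j - 1\<close>, and the last vertex hangs on the branching
  vertex in types D and E.
\<close>

lemma dynkin_quiver_oriented_tree:
  assumes "dynkin_quiver Q"
  shows "oriented_tree (tail Q) (head Q) (verts Q) (arcs Q)"
proof -
  obtain n E \<phi> where *: "wf_digraph Q" "simply_laced_dynkin n E" "bij_betw \<phi> (verts Q) {..<n}"
    "bij_betw (\<lambda>a. {\<phi> (tail Q a), \<phi> (head Q a)}) (arcs Q) E"
    using assms by (auto simp: dynkin_quiver_def)
  moreover obtain p where "n \<ge> 1" "\<And>j. 1 \<le> j \<Longrightarrow> j < n \<Longrightarrow> p j < j" "E = (\<lambda>j. {p j, j}) ` {1..<n}"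
    using simply_laced_dynkin_parent[OF *(2)] by blast
  ultimately show ?thesis
    by (intro oriented_tree_parent[where p = p and \<phi> = \<phi> and n = n])
      (auto simp: wf_digraph_def)
qed

definition arc_rel :: "('a \<Rightarrow> 'v) \<Rightarrow> ('a \<Rightarrow> 'v) \<Rightarrow> 'a set \<Rightarrow> 'v rel" where
  "arc_rel t h A = (\<lambda>a. (t a, h a)) ` A"

text \<open>
  The maps \<open>F\<close> of the arcs transport an element \<open>m\<close> at \<open>v\<close> along all directed paths that start at
  \<open>v\<close>, and in a tree the result at a vertex is independent of the path. The maps \<open>F\<close> are arbitrary,
  and so the lemma expresses that there is at most one directed path from \<open>v\<close> to a vertex. The
  induction attaches a leaf \<open>l\<close>, which is a source or a sink.
\<close>

lemma oriented_tree_propagate: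
  assumes "oriented_tree t h V A" and "v \<in> V"
  shows "\<exists>x. x v = m \<and> (\<forall>a\<in>A. (v, t a) \<in> (arc_rel t h A)\<^sup>* \<longrightarrow> x (h a) = F a (x (t a)))"
  using assms
proof (induction arbitrary: v m rule: oriented_tree.induct)
  case (single r)
  then show ?case by (auto intro: exI[of _ "\<lambda>_. m"])
next
  case (leaf V A p l a)
  let ?R = "arc_rel t h A"
  have ends: "t b \<in> V \<and> h b \<in> V" if "b \<in> A" for b
    using leaf.hyps(1) that by (induction) (auto simp: doubleton_eq_iff)
  \<comment> \<open>Before the new arc is added, \<open>l\<close> is an isolated vertex.\<close>
  have from_l: "w = l" if "(l, w) \<in> ?R\<^sup>*" for w
    using that leaf.hyps(3) ends
    by (induction rule: converse_rtrancl_induct) (auto simp: arc_rel_def elim: converse_rtranclE)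
  have to_l: "w = l" if "(w, l) \<in> ?R\<^sup>*" for w
    using that leaf.hyps(3) ends by (auto simp: arc_rel_def elim: rtranclE)
  have R: "arc_rel t h (insert a A) = insert (t a, h a) ?R"
    by (simp add: arc_rel_def)
  have neq: "b \<in> A \<Longrightarrow> t b \<noteq> l \<and> h b \<noteq> l" for b using ends leaf.hyps(3) by auto
  consider (sink) "t a = p" "h a = l" | (source) "t a = l" "h a = p"
    using leaf.hyps(5) by (auto simp: doubleton_eq_iff)
  then show ?case
  proof cases
    case sink
    show ?thesis
    proof (cases "v = l")
      case True
      then show ?thesis
        using neq from_l leaf.hyps(2,3) unfolding R rtrancl_insert sink
        by (intro exI[of _ "\<lambda>_. m"]) (auto simp: sink dest!: from_l)
    next
      case False
      then obtain x where x: "x v = m" "\<And>b. b \<in> A \<Longrightarrow> (v, t b) \<in> ?R\<^sup>* \<Longrightarrow> x (h b) = F b (x (t b))"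
        using leaf.IH[of v m] leaf.prems by auto
      have "(v, t b) \<in> ?R\<^sup>*" if "b \<in> A" "(v, t b) \<in> (insert (p, l) ?R)\<^sup>*" for b
        using that neq[of b] by (auto simp: rtrancl_insert dest!: from_l)
      then show ?thesis
        using x neq False leaf.hyps(2,3) unfolding R sink
        by (intro exI[of _ "x(l := F a (x p))"]) (auto simp: sink)
    qed
  next
    case source
    show ?thesis
    proof (cases "v = l")
      case True
      obtain x where x: "x p = F a m" "\<And>b. b \<in> A \<Longrightarrow> (p, t b) \<in> ?R\<^sup>* \<Longrightarrow> x (h b) = F b (x (t b))"
        using leaf.IH[of p "F a m"] leaf.hyps by auto
      have "(p, t b) \<in> ?R\<^sup>*" if "b \<in> A" "(l, t b) \<in> (insert (l, p) ?R)\<^sup>*" for b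
        using that neq[of b] by (auto simp: rtrancl_insert dest!: from_l)
      then show ?thesis
        using x neq True leaf.hyps(2,3) unfolding R source
        by (intro exI[of _ "x(l := m)"]) (auto simp: source)
    next
      case False
      then obtain x where x: "x v = m" "\<And>b. b \<in> A \<Longrightarrow> (v, t b) \<in> ?R\<^sup>* \<Longrightarrow> x (h b) = F b (x (t b))"
        using leaf.IH[of v m] leaf.prems by auto
      have "(v, l) \<notin> ?R\<^sup>*" using False to_l by blast
      then show ?thesis
        using x unfolding R source
        by (intro exI[of _ x]) (auto simp: source rtrancl_insert)
    qed
  qed
qed

lemma oriented_tree_finite: "oriented_tree t h V A \<Longrightarrow> finite V"
  by (induction rule: oriented_tree.induct) auto


section \<open>The category of representations\<close>

lemma rep_hom_lin: "f \<in> rep_hom s Q M N \<Longrightarrow> v \<in> verts Q \<Longrightarrow> f v \<in> lin_maps s s (space M v) (space N v)"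
  by (simp add: rep_hom_def)

lemma rep_hom_outside: "f \<in> rep_hom s Q M N \<Longrightarrow> v \<notin> verts Q \<Longrightarrow> f v = 0"
  by (simp add: rep_hom_def)

lemma rep_hom_arr:
  "f \<in> rep_hom s Q M N \<Longrightarrow> a \<in> arcs Q \<Longrightarrow> x \<in> space M (tail Q a) \<Longrightarrow>
    f (head Q a) (arr M a x) = arr N a (f (tail Q a) x)"
  by (simp add: rep_hom_def)

lemma rep_hom_mem: "f \<in> rep_hom s Q M N \<Longrightarrow> v \<in> verts Q \<Longrightarrow> x \<in> space M v \<Longrightarrow> f v x \<in> space N v"
  by (rule lin_maps_mem[OF rep_hom_lin])

lemma rep_hom_zero: "f \<in> rep_hom s Q M N \<Longrightarrow> f v 0 = 0"
  by (cases "v \<in> verts Q") (auto dest: rep_hom_lin rep_hom_outside intro: lin_maps_zero)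

lemma rep_hom_eqI:
  assumes "f \<in> rep_hom s Q M N" "g \<in> rep_hom s Q M N"
    and "\<And>v x. v \<in> verts Q \<Longrightarrow> x \<in> space M v \<Longrightarrow> f v x = g v x"
  shows "f = g"
proof (intro ext)
  fix v x
  show "f v x = g v x"
    using assms lin_maps_outside[OF rep_hom_lin[OF assms(1)]]
      lin_maps_outside[OF rep_hom_lin[OF assms(2)]] rep_hom_outside[OF assms(1)]
      rep_hom_outside[OF assms(2)]
    by (cases "v \<in> verts Q"; cases "x \<in> space M v") auto
qed

lemma is_rep_space: "is_rep s Q M \<Longrightarrow> v \<in> verts Q \<Longrightarrow> fd_subspace s (space M v)"
  by (simp add: is_rep_def)

lemma is_rep_subspace: "is_rep s Q M \<Longrightarrow> v \<in> verts Q \<Longrightarrow> module.subspace s (space M v)"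
  by (simp add: is_rep_def fd_subspace_def)

lemma is_rep_arr:
  "is_rep s Q M \<Longrightarrow> a \<in> arcs Q \<Longrightarrow>
    arr M a \<in> lin_maps s s (space M (tail Q a)) (space M (head Q a))"
  by (simp add: is_rep_def)

lemma rep_comp_assoc: "rep_comp h (rep_comp g f) = rep_comp (rep_comp h g) f"
  by (simp add: rep_comp_def fun_eq_iff)

lemma rep_comp_id_right: "f \<in> rep_hom s Q M N \<Longrightarrow> rep_comp f (rep_id Q M) = f"
  by (auto simp: fun_eq_iff rep_comp_def rep_id_def rep_hom_zero id_map_def rep_hom_outside
      dest: rep_hom_lin lin_maps_outside)

lemma rep_comp_id_left: "f \<in> rep_hom s Q M N \<Longrightarrow> rep_comp (rep_id Q N) f = f"
  using lin_maps_id_left[OF rep_hom_lin] rep_hom_outside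
  by (fastforce simp: fun_eq_iff rep_comp_def rep_id_def)

locale quiver_reps = vector_space s
  for s :: "'k::field \<Rightarrow> 'u::ab_group_add \<Rightarrow> 'u" +
  fixes Q :: "('v, 'a) pre_digraph"
  assumes wf: "wf_digraph Q" and finite_verts: "finite (verts Q)"
begin

lemma arc_ends: "a \<in> arcs Q \<Longrightarrow> tail Q a \<in> verts Q \<and> head Q a \<in> verts Q"
  using wf by (simp add: wf_digraph_def)

lemma rep_comp_in_hom:
  assumes f: "f \<in> rep_hom s Q M N" and g: "g \<in> rep_hom s Q N L"
  shows "rep_comp g f \<in> rep_hom s Q M L"
  using arc_ends rep_hom_arr[OF f] rep_hom_arr[OF g] rep_hom_mem[OF f]
    lin_maps_comp[OF rep_hom_lin[OF f] rep_hom_lin[OF g]]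
    rep_hom_outside[OF f] rep_hom_outside[OF g]
  by (auto simp: rep_hom_def[of s Q M L] rep_comp_def fun_eq_iff)

lemma rep_id_in_hom:
  assumes M: "is_rep s Q M"
  shows "rep_id Q M \<in> rep_hom s Q M M"
  using id_map_in_lin_maps is_rep_subspace[OF M] arc_ends lin_maps_mem[OF is_rep_arr[OF M]]
  by (auto simp: rep_hom_def rep_id_def id_map_def[abs_def])

lemma category_mod_kQ: "category (mod_kQ s Q)"
  by (auto simp: category_def mod_kQ_def rep_id_in_hom rep_comp_in_hom rep_comp_id_left
      rep_comp_id_right rep_comp_assoc)

lemma vector_space_rep_mor: "vector_space (rep_mor_scale s)"
  by unfold_locales (auto simp: rep_mor_scale_def fun_eq_iff scale_right_distrib scale_left_distrib)

sublocale mor: vector_space "rep_mor_scale s"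
  by (rule vector_space_rep_mor)

lemma subspace_rep_hom:
  assumes N: "is_rep s Q N"
  shows "mor.subspace (rep_hom s Q M N)"
proof (rule mor.subspaceI)
  show "0 \<in> rep_hom s Q M N"
    using subspace_0[OF is_rep_subspace[OF N]] lin_maps_zero[OF is_rep_arr[OF N]]
    by (auto simp: rep_hom_def lin_maps_def)
next
  fix f g assume f: "f \<in> rep_hom s Q M N" and g: "g \<in> rep_hom s Q M N"
  show "f + g \<in> rep_hom s Q M N"
    unfolding rep_hom_def[of s Q M N]
  proof (clarsimp, intro conjI ballI)
    fix v assume v: "v \<in> verts Q"
    show "f v + g v \<in> lin_maps s s (space M v) (space N v)"
      using rep_hom_lin[OF f v] rep_hom_lin[OF g v] subspace_add[OF is_rep_subspace[OF N v]]
      by (auto simp: lin_maps_def scale_right_distrib)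
  next
    show "\<forall>v. v \<notin> verts Q \<longrightarrow> f v + g v = 0"
      using rep_hom_outside[OF f] rep_hom_outside[OF g] by auto
  next
    fix a x assume a: "a \<in> arcs Q" and x: "x \<in> space M (tail Q a)"
    show "f (head Q a) (arr M a x) + g (head Q a) (arr M a x) =
        arr N a (f (tail Q a) x + g (tail Q a) x)"
      using rep_hom_arr[OF f a x] rep_hom_arr[OF g a x] rep_hom_mem[OF f _ x] rep_hom_mem[OF g _ x]
        arc_ends[OF a] by (simp add: lin_maps_add[OF is_rep_arr[OF N a]])
  qed
next
  fix c f assume f: "f \<in> rep_hom s Q M N"
  show "rep_mor_scale s c f \<in> rep_hom s Q M N"
    unfolding rep_hom_def[of s Q M N]
  proof (clarsimp, intro conjI ballI)
    fix v assume v: "v \<in> verts Q"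
    show "rep_mor_scale s c f v \<in> lin_maps s s (space M v) (space N v)"
      using rep_hom_lin[OF f v] subspace_scale[OF is_rep_subspace[OF N v]]
      by (auto simp: lin_maps_def rep_mor_scale_def scale_right_distrib scale_left_commute)
  next
    show "\<forall>v. v \<notin> verts Q \<longrightarrow> rep_mor_scale s c f v = 0"
      using rep_hom_outside[OF f] by (auto simp: rep_mor_scale_def fun_eq_iff)
  next
    fix a x assume a: "a \<in> arcs Q" and x: "x \<in> space M (tail Q a)"
    show "rep_mor_scale s c f (head Q a) (arr M a x) = arr N a (rep_mor_scale s c f (tail Q a) x)"
      using rep_hom_arr[OF f a x] rep_hom_mem[OF f _ x] arc_ends[OF a]
      by (simp add: rep_mor_scale_def lin_maps_scale[OF is_rep_arr[OF N a]])
  qed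
qed

text \<open>
  With bases of the spaces of \<open>M\<close> and \<open>N\<close>, a morphism is at each vertex a combination of matrix
  units \<open>E\<close>. These need not commute with the arrows; they span a finite dimensional space of families
  of maps that contains all morphisms.
\<close>

lemma rep_hom_finitely_spanned:
  assumes M: "is_rep s Q M" and N: "is_rep s Q N"
  shows "\<exists>T. finite T \<and> rep_hom s Q M N \<subseteq> mor.span T"
proof -
  have "\<exists>B. finite B \<and> independent B \<and> B \<subseteq> space M v \<and> space M v = span B" if "v \<in> verts Q" for v
    using fd_subspace_basis[OF is_rep_space[OF M that]] by metis
  then obtain B where B: "\<And>v. v \<in> verts Q \<Longrightarrow>
      finite (B v) \<and> independent (B v) \<and> B v \<subseteq> space M v \<and> space M v = span (B v)"
    by metis
  have "\<exists>C. finite C \<and> independent C \<and> C \<subseteq> space N v \<and> space N v = span C" if "v \<in> verts Q" for v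
    using fd_subspace_basis[OF is_rep_space[OF N that]] by metis
  then obtain C where C: "\<And>v. v \<in> verts Q \<Longrightarrow>
      finite (C v) \<and> independent (C v) \<and> C v \<subseteq> space N v \<and> space N v = span (C v)"
    by metis
  define E where "E v b c = (\<lambda>w x. if w = v \<and> x \<in> space M v then s (representation (B v) x b) c else 0)"
    for v b c
  define T where "T = (\<Union>v\<in>verts Q. \<Union>b\<in>B v. E v b ` C v)"
  have "finite T" unfolding T_def using B C finite_verts by auto
  moreover have "f \<in> mor.span T" if f: "f \<in> rep_hom s Q M N" for f
  proof -
    let ?g = "\<Sum>v\<in>verts Q. \<Sum>b\<in>B v. \<Sum>c\<in>C v.
        rep_mor_scale s (representation (C v) (f v b) c) (E v b c)"
    have app: "sum F I w x = (\<Sum>i\<in>I. F i w x)" for F :: "'i \<Rightarrow> ('v, 'u) rep_mor" and I w x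
      by (induction I rule: infinite_finite_induct) auto
    have "f w x = ?g w x" for w x
    proof (cases "w \<in> verts Q \<and> x \<in> space M w")
      case True
      then have w: "w \<in> verts Q" and x: "x \<in> space M w" by auto
      note fw = rep_hom_lin[OF f w]
      have "f w x = f w (\<Sum>b\<in>B w. s (representation (B w) x b) b)"
        using B[OF w] x by (simp add: sum_representation_eq)
      also have "\<dots> = (\<Sum>b\<in>B w. f w (s (representation (B w) x b) b))"
        using B[OF w] subspace_scale[OF is_rep_subspace[OF M w]]
        by (intro lin_maps_sum[OF fw is_rep_subspace[OF M w]]) auto
      also have "\<dots> = (\<Sum>b\<in>B w. \<Sum>c\<in>C w. s (representation (C w) (f w b) c) (E w b c w x))"
      proof (rule sum.cong)
        fix b assume b: "b \<in> B w"
        have bM: "b \<in> space M w" using B[OF w] b by auto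
        have "f w (s (representation (B w) x b) b) = s (representation (B w) x b) (f w b)"
          by (rule lin_maps_scale[OF fw bM])
        also have "f w b = (\<Sum>c\<in>C w. s (representation (C w) (f w b) c) c)"
          using C[OF w] rep_hom_mem[OF f w bM] by (simp add: sum_representation_eq)
        also have "s (representation (B w) x b) \<dots> =
            (\<Sum>c\<in>C w. s (representation (C w) (f w b) c) (E w b c w x))"
          using x by (simp add: E_def scale_sum_right mult.commute)
        finally show "f w (s (representation (B w) x b) b) =
            (\<Sum>c\<in>C w. s (representation (C w) (f w b) c) (E w b c w x))" .
      qed simp
      also have "\<dots> = (\<Sum>v\<in>verts Q. if v = w then
          \<Sum>b\<in>B v. \<Sum>c\<in>C v. s (representation (C v) (f v b) c) (E v b c w x) else 0)"
        using w finite_verts by simp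
      also have "\<dots> = ?g w x"
        unfolding app rep_mor_scale_def by (intro sum.cong refl) (auto simp: E_def)
      finally show ?thesis .
    next
      case False
      then have "f w x = 0"
        using rep_hom_outside[OF f] lin_maps_outside[OF rep_hom_lin[OF f]] by fastforce
      moreover have "?g w x = 0"
        unfolding app using False by (auto simp: rep_mor_scale_def E_def intro!: sum.neutral)
      ultimately show ?thesis by simp
    qed
    then have "f = ?g" by blast
    also have "?g \<in> mor.span T"
      by (intro mor.span_sum mor.span_scale mor.span_base) (auto simp: T_def)
    finally show ?thesis .
  qed
  ultimately show ?thesis by blast
qed

section \<open>The functor on representations\<close>

lemma H_catD:
  assumes "X \<in> obj (H_cat s Q)"
  shows "is_rep s Q (src X)" "is_rep s Q (tgt X)" "incl X \<in> rep_hom s Q (src X) (tgt X)"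
  using assms by (auto simp: H_cat_def hom_mono_def projective_rep_def)

lemma H_cat_homD:
  assumes "f \<in> hom (H_cat s Q) X Y"
  shows "fst f \<in> rep_hom s Q (src X) (src Y)" "snd f \<in> rep_hom s Q (tgt X) (tgt Y)"
    "rep_comp (snd f) (incl X) = rep_comp (incl Y) (fst f)"
  using assms by (auto simp: H_cat_def hom_mono_def)

lemma H_cat_idt: "idt (H_cat s Q) X = (rep_id Q (src X), rep_id Q (tgt X))"
  by (simp add: H_cat_def hom_mono_def)

lemma fst_H_cat_cmp: "fst (cmp (H_cat s Q) g f) = rep_comp (fst g) (fst f)"
  by (simp add: H_cat_def hom_mono_def split: prod.split)

lemma Lambda_fmor:
  "fmor (Lambda_obj s Q M) X Y f h = (if h \<in> hat_obj s Q M Y then rep_comp h (fst f) else 0)"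
  by (simp add: Lambda_obj_def split: prod.split)

lemma Lambda_fobj: "fobj (Lambda_obj s Q M) = hat_obj s Q M"
  by (simp add: Lambda_obj_def)

lemma hat_obj_sub_hom: "X \<in> obj (H_cat s Q) \<Longrightarrow> h \<in> hat_obj s Q M X \<Longrightarrow> h \<in> rep_hom s Q (src X) M"
  by (auto simp: hat_obj_def intro: rep_comp_in_hom[OF H_catD(3)])

text \<open>
  If \<open>h = g \<circ> \<iota>'\<close> and \<open>(\<phi>, \<psi>)\<close> is a morphism from \<open>\<iota>\<close> to \<open>\<iota>'\<close>, then \<open>h \<circ> \<phi> = (g \<circ> \<psi>) \<circ> \<iota>\<close> still
  extends along \<open>\<iota>\<close>.
\<close>

lemma hat_obj_precomp:
  assumes f: "f \<in> hom (H_cat s Q) X Y" and h: "h \<in> hat_obj s Q M Y"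
  shows "rep_comp h (fst f) \<in> hat_obj s Q M X"
proof -
  obtain g where g: "g \<in> rep_hom s Q (tgt Y) M" "h = rep_comp g (incl Y)"
    using h by (auto simp: hat_obj_def)
  then have "rep_comp h (fst f) = rep_comp (rep_comp g (snd f)) (incl X)"
    using H_cat_homD(3)[OF f] by (metis rep_comp_assoc)
  then show ?thesis
    using rep_comp_in_hom[OF H_cat_homD(2)[OF f] g(1)] by (auto simp: hat_obj_def)
qed

lemma hat_obj_postcomp:
  assumes f: "f \<in> rep_hom s Q M N" and h: "h \<in> hat_obj s Q M X"
  shows "rep_comp f h \<in> hat_obj s Q N X"
  using h rep_comp_in_hom[OF _ f] by (auto simp: hat_obj_def rep_comp_assoc)

lemma fd_subspace_hat_obj:
  assumes X: "X \<in> obj (H_cat s Q)" and M: "is_rep s Q M"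
  shows "fd_subspace (rep_mor_scale s) (hat_obj s Q M X)"
proof -
  note hom_sub = subspace_rep_hom[OF M, of "tgt X"]
  have "mor.subspace (hat_obj s Q M X)"
  proof (rule mor.subspaceI)
    show "0 \<in> hat_obj s Q M X"
      unfolding hat_obj_def using mor.subspace_0[OF hom_sub]
      by (intro image_eqI[of _ _ 0]) (auto simp: rep_comp_def fun_eq_iff)
  next
    fix f g assume "f \<in> hat_obj s Q M X" "g \<in> hat_obj s Q M X"
    then obtain f' g' where "f' \<in> rep_hom s Q (tgt X) M" "f = rep_comp f' (incl X)"
      "g' \<in> rep_hom s Q (tgt X) M" "g = rep_comp g' (incl X)"
      by (auto simp: hat_obj_def)
    then show "f + g \<in> hat_obj s Q M X"
      unfolding hat_obj_def using mor.subspace_add[OF hom_sub]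
      by (intro image_eqI[of _ _ "f' + g'"]) (auto simp: rep_comp_def fun_eq_iff)
  next
    fix c f assume "f \<in> hat_obj s Q M X"
    then obtain f' where "f' \<in> rep_hom s Q (tgt X) M" "f = rep_comp f' (incl X)"
      by (auto simp: hat_obj_def)
    then show "rep_mor_scale s c f \<in> hat_obj s Q M X"
      unfolding hat_obj_def using mor.subspace_scale[OF hom_sub]
      by (intro image_eqI[of _ _ "rep_mor_scale s c f'"])
        (auto simp: rep_comp_def fun_eq_iff rep_mor_scale_def)
  qed
  moreover obtain T where "finite T" "rep_hom s Q (src X) M \<subseteq> mor.span T"
    using rep_hom_finitely_spanned[OF H_catD(1)[OF X] M] by blast
  ultimately show ?thesis
    using hat_obj_sub_hom[OF X] by (intro mor.fd_subspaceI) auto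
qed

lemma rep_comp_zero_left: "rep_comp 0 f = 0"
  by (simp add: rep_comp_def fun_eq_iff)

lemma rep_comp_zero_right: "f \<in> rep_hom s Q M N \<Longrightarrow> rep_comp f 0 = 0"
  by (simp add: rep_comp_def fun_eq_iff rep_hom_zero)

lemma rep_comp_add_left: "rep_comp (f + g) h = rep_comp f h + rep_comp g h"
  by (simp add: rep_comp_def fun_eq_iff)

lemma rep_comp_scale_left: "rep_comp (rep_mor_scale s c f) h = rep_mor_scale s c (rep_comp f h)"
  by (simp add: rep_comp_def rep_mor_scale_def fun_eq_iff)

lemma rep_comp_add_right:
  assumes h: "h \<in> rep_hom s Q M N" and f: "f \<in> rep_hom s Q L M" and g: "g \<in> rep_hom s Q L M"
  shows "rep_comp h (f + g) = rep_comp h f + rep_comp h g"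
proof (intro ext)
  fix v x
  show "rep_comp h (f + g) v x = (rep_comp h f + rep_comp h g) v x"
  proof (cases "v \<in> verts Q \<and> x \<in> space L v")
    case True
    then show ?thesis
      using lin_maps_add[OF rep_hom_lin[OF h]] rep_hom_mem[OF f] rep_hom_mem[OF g]
      by (simp add: rep_comp_def)
  next
    case False
    then have "f v x = 0" "g v x = 0"
      using rep_hom_outside[OF f] lin_maps_outside[OF rep_hom_lin[OF f]]
        rep_hom_outside[OF g] lin_maps_outside[OF rep_hom_lin[OF g]] by fastforce+
    then show ?thesis by (simp add: rep_comp_def rep_hom_zero[OF h])
  qed
qed

lemma rep_comp_scale_right:
  assumes h: "h \<in> rep_hom s Q M N" and f: "f \<in> rep_hom s Q L M"
  shows "rep_comp h (rep_mor_scale s c f) = rep_mor_scale s c (rep_comp h f)"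
proof (intro ext)
  fix v x
  show "rep_comp h (rep_mor_scale s c f) v x = rep_mor_scale s c (rep_comp h f) v x"
  proof (cases "v \<in> verts Q \<and> x \<in> space L v")
    case True
    then show ?thesis
      using lin_maps_scale[OF rep_hom_lin[OF h]] rep_hom_mem[OF f]
      by (simp add: rep_comp_def rep_mor_scale_def)
  next
    case False
    then have "f v x = 0"
      using rep_hom_outside[OF f] lin_maps_outside[OF rep_hom_lin[OF f]] by fastforce
    then show ?thesis by (simp add: rep_comp_def rep_mor_scale_def rep_hom_zero[OF h])
  qed
qed

lemma cat_module_Lambda_obj:
  assumes M: "is_rep s Q M"
  shows "cat_module (mono_mor_scale s) (H_cat s Q) (rep_mor_scale s) (Lambda_obj s Q M)"
  unfolding cat_module_def Lambda_fobj
proof (intro conjI ballI allI)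
  fix X assume X: "X \<in> obj (H_cat s Q)"
  show "fd_subspace (rep_mor_scale s) (hat_obj s Q M X)"
    by (rule fd_subspace_hat_obj[OF X M])
  show "fmor (Lambda_obj s Q M) X X (idt (H_cat s Q) X) = id_map (hat_obj s Q M X)"
    by (auto simp: fun_eq_iff[where f = "fmor _ _ _ _"] Lambda_fmor H_cat_idt id_map_def
        rep_comp_id_right[OF hat_obj_sub_hom[OF X]])
next
  fix X Y f assume X: "X \<in> obj (H_cat s Q)" and Y: "Y \<in> obj (H_cat s Q)"
    and f: "f \<in> hom (H_cat s Q) X Y"
  have sub: "mor.subspace (hat_obj s Q M Y)"
    using fd_subspace_hat_obj[OF Y M] by (simp add: fd_subspace_def)
  show "fmor (Lambda_obj s Q M) X Y f
      \<in> lin_maps (rep_mor_scale s) (rep_mor_scale s) (hat_obj s Q M Y) (hat_obj s Q M X)"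
    using mor.subspace_add[OF sub] mor.subspace_scale[OF sub] hat_obj_precomp[OF f]
    by (auto simp: lin_maps_def Lambda_fmor rep_comp_add_left rep_comp_scale_left)
  show "fmor (Lambda_obj s Q M) X Y (mono_mor_scale s c f) =
      (\<lambda>h. rep_mor_scale s c (fmor (Lambda_obj s Q M) X Y f h))" for c
    by (auto simp: fun_eq_iff[where f = "fmor _ _ _ _"] Lambda_fmor mono_mor_scale_def
        rep_comp_scale_right[OF hat_obj_sub_hom[OF Y] H_cat_homD(1)[OF f]])
  fix g assume g: "g \<in> hom (H_cat s Q) X Y"
  show "fmor (Lambda_obj s Q M) X Y (f + g) =
      fmor (Lambda_obj s Q M) X Y f + fmor (Lambda_obj s Q M) X Y g"
    by (auto simp: fun_eq_iff[where f = "fmor _ _ _ _"] Lambda_fmor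
        rep_comp_add_right[OF hat_obj_sub_hom[OF Y] H_cat_homD(1)[OF f] H_cat_homD(1)[OF g]])
next
  fix X Y Z f g assume Y: "Y \<in> obj (H_cat s Q)" and f: "f \<in> hom (H_cat s Q) X Y"
    and g: "g \<in> hom (H_cat s Q) Y Z"
  show "fmor (Lambda_obj s Q M) X Z (cmp (H_cat s Q) g f) =
      fmor (Lambda_obj s Q M) X Y f \<circ> fmor (Lambda_obj s Q M) Y Z g"
    by (auto simp: fun_eq_iff[where f = "fmor _ _ _ _"] Lambda_fmor fst_H_cat_cmp
        rep_comp_assoc rep_comp_zero_left hat_obj_precomp[OF g])
qed

lemma zero_in_hat_obj: "X \<in> obj (H_cat s Q) \<Longrightarrow> is_rep s Q M \<Longrightarrow> 0 \<in> hat_obj s Q M X"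
  using fd_subspace_hat_obj[of X M] mor.subspace_0[of "hat_obj s Q M X"] by (simp add: fd_subspace_def)

lemma nat_trans_Lambda_mor:
  assumes M: "is_rep s Q M" and N: "is_rep s Q N" and f: "f \<in> rep_hom s Q M N"
  shows "Lambda_mor s Q M N f
    \<in> nat_trans (H_cat s Q) (rep_mor_scale s) (Lambda_obj s Q M) (Lambda_obj s Q N)"
  unfolding nat_trans_def Lambda_fobj
proof (intro CollectI conjI ballI allI impI)
  fix X assume X: "X \<in> obj (H_cat s Q)"
  have sub: "mor.subspace (hat_obj s Q M X)"
    using fd_subspace_hat_obj[OF X M] by (simp add: fd_subspace_def)
  show "Lambda_mor s Q M N f X
      \<in> lin_maps (rep_mor_scale s) (rep_mor_scale s) (hat_obj s Q M X) (hat_obj s Q N X)"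
    using X mor.subspace_add[OF sub] mor.subspace_scale[OF sub] hat_obj_postcomp[OF f]
      rep_comp_add_right[OF f hat_obj_sub_hom[OF X] hat_obj_sub_hom[OF X]]
      rep_comp_scale_right[OF f hat_obj_sub_hom[OF X]]
    by (auto simp: lin_maps_def Lambda_mor_def)
  fix Y g assume Y: "Y \<in> obj (H_cat s Q)" and g: "g \<in> hom (H_cat s Q) X Y"
  show "Lambda_mor s Q M N f X \<circ> fmor (Lambda_obj s Q M) X Y g =
      fmor (Lambda_obj s Q N) X Y g \<circ> Lambda_mor s Q M N f Y"
  proof
    fix h
    show "(Lambda_mor s Q M N f X \<circ> fmor (Lambda_obj s Q M) X Y g) h =
      (fmor (Lambda_obj s Q N) X Y g \<circ> Lambda_mor s Q M N f Y) h"
      using X Y zero_in_hat_obj[OF X M] zero_in_hat_obj[OF Y N] hat_obj_postcomp[OF f]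
        hat_obj_precomp[OF g]
      by (simp add: Lambda_fmor Lambda_mor_def rep_comp_zero_left rep_comp_zero_right[OF f]
          rep_comp_assoc)
  qed
qed (simp add: Lambda_mor_def fun_eq_iff[where g = 0])

end

lemma category_cat_modules:
  assumes "vector_space sw"
  shows "category (cat_modules sm C sw)"
proof -
  have cmp: "(\<lambda>X. \<theta> X \<circ> \<eta> X) \<in> nat_trans C sw F H"
    if \<eta>: "\<eta> \<in> nat_trans C sw F G" and \<theta>: "\<theta> \<in> nat_trans C sw G H" for F G H \<eta> \<theta>
  proof -
    have "(\<theta> X \<circ> \<eta> X) \<circ> fmor F X Y f = fmor H X Y f \<circ> (\<theta> Y \<circ> \<eta> Y)"
      if "X \<in> obj C" "Y \<in> obj C" "f \<in> hom C X Y" for X Y f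
      using \<eta> \<theta> that unfolding nat_trans_def by (simp add: comp_assoc) (simp flip: comp_assoc)
    then show ?thesis
      using \<eta> \<theta> unfolding nat_trans_def by (auto intro: lin_maps_comp)
  qed
  have id: "(\<lambda>X. if X \<in> obj C then id_map (fobj F X) else 0) \<in> nat_trans C sw F F"
    if F: "cat_module sm C sw F" for F
  proof -
    have "id_map (fobj F X) \<in> lin_maps sw sw (fobj F X) (fobj F X)" if X: "X \<in> obj C" for X
      using F X vector_space.id_map_in_lin_maps[OF assms]
      by (simp add: cat_module_def fd_subspace_def)
    moreover have "id_map (fobj F X) \<circ> fmor F X Y f = fmor F X Y f \<circ> id_map (fobj F Y)"
      if "X \<in> obj C" "Y \<in> obj C" "f \<in> hom C X Y" for X Y f
    proof -
      have "fmor F X Y f \<in> lin_maps sw sw (fobj F Y) (fobj F X)"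
        using F that unfolding cat_module_def by blast
      then show ?thesis by (simp add: lin_maps_id_left lin_maps_id_right)
    qed
    ultimately show ?thesis by (auto simp: nat_trans_def)
  qed
  have "\<eta> X \<circ> (if X \<in> obj C then id_map (fobj F X) else 0) = \<eta> X"
    and "(if X \<in> obj C then id_map (fobj G X) else 0) \<circ> \<eta> X = \<eta> X"
    if "\<eta> \<in> nat_trans C sw F G" for F G \<eta> X
    using that by (cases "X \<in> obj C"; fastforce simp: nat_trans_def intro: lin_maps_id_left lin_maps_id_right)+
  then show ?thesis
    using cmp id by (auto simp: category_def cat_modules_def comp_assoc)
qed

lemma (in quiver_reps) is_functor_Lambda:
  "is_functor (mod_kQ s Q) (mod_Hop s Q) (Lambda_obj s Q) (Lambda_mor s Q)"
proof -
  have "Lambda_mor s Q M M (rep_id Q M) =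
      idt (mod_Hop s Q) (Lambda_obj s Q M)" for M
  proof (intro ext)
    fix X h v x
    show "Lambda_mor s Q M M (rep_id Q M) X h v x =
        idt (mod_Hop s Q) (Lambda_obj s Q M) X h v x"
      by (auto simp: Lambda_mor_def mod_Hop_def cat_modules_def Lambda_fobj id_map_def
          rep_comp_id_left[OF hat_obj_sub_hom])
  qed
  moreover have "Lambda_mor s Q M L (rep_comp g f) =
      cmp (mod_Hop s Q) (Lambda_mor s Q N L g) (Lambda_mor s Q M N f)"
    if "f \<in> rep_hom s Q M N" "g \<in> rep_hom s Q N L" for M N L f g
  proof (intro ext)
    fix X h v x
    show "Lambda_mor s Q M L (rep_comp g f) X h v x =
        cmp (mod_Hop s Q) (Lambda_mor s Q N L g) (Lambda_mor s Q M N f) X h v x"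
      using that hat_obj_postcomp rep_comp_zero_right
      by (auto simp: Lambda_mor_def mod_Hop_def cat_modules_def rep_comp_assoc)
  qed
  moreover have "category (mod_Hop s Q)"
    by (simp add: mod_Hop_def category_cat_modules[OF vector_space_rep_mor])
  moreover have "obj (mod_Hop s Q) = {F. cat_module (mono_mor_scale s) (H_cat s Q) (rep_mor_scale s) F}"
    and "hom (mod_Hop s Q) = nat_trans (H_cat s Q) (rep_mor_scale s)"
    by (simp_all add: mod_Hop_def cat_modules_def)
  ultimately show ?thesis
    using category_mod_kQ cat_module_Lambda_obj nat_trans_Lambda_mor
    by (simp add: is_functor_def) (simp add: mod_kQ_def)
qed

section \<open>The thin projectives of an oriented tree\<close>

text \<open>
  The projective generated by \<open>v\<close>. The vector \<open>e\<close> at \<open>w\<close> stands for the unique path from \<open>v\<close> to \<open>w\<close>,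
  and arrows extend paths, so between two reachable vertices they act as the identity of the line.
\<close>

definition thin_proj ::
  "('k::field \<Rightarrow> 'u::ab_group_add \<Rightarrow> 'u) \<Rightarrow> ('v, 'a) pre_digraph \<Rightarrow> 'u \<Rightarrow> 'v \<Rightarrow> ('v, 'a, 'u) rep" where
  "thin_proj s Q e v = \<lparr>
     space = (\<lambda>w. if (v, w) \<in> (arc_rel (tail Q) (head Q) (arcs Q))\<^sup>* then module.span s {e} else {0}),
     arr = (\<lambda>a x. if (v, tail Q a) \<in> (arc_rel (tail Q) (head Q) (arcs Q))\<^sup>* \<and> x \<in> module.span s {e}
       then x else 0)\<rparr>"

locale tree_quiver_reps = quiver_reps s Q
  for s :: "'k::field \<Rightarrow> 'u::ab_group_add \<Rightarrow> 'u" and Q :: "('v, 'a) pre_digraph" +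
  fixes e :: 'u
  assumes tree: "oriented_tree (tail Q) (head Q) (verts Q) (arcs Q)" and e_nonzero: "e \<noteq> 0"
begin

abbreviation reach :: "'v \<Rightarrow> 'v \<Rightarrow> bool" where
  "reach v w \<equiv> (v, w) \<in> (arc_rel (tail Q) (head Q) (arcs Q))\<^sup>*"

abbreviation P :: "'v \<Rightarrow> ('v, 'a, 'u) rep" where
  "P v \<equiv> thin_proj s Q e v"

lemma reach_arc: "a \<in> arcs Q \<Longrightarrow> reach v (tail Q a) \<Longrightarrow> reach v (head Q a)"
  by (rule rtrancl_into_rtrancl) (auto simp: arc_rel_def)

lemma reach_induct [consumes 1, case_names refl arc]:
  assumes "reach v w" "R v" "\<And>a. a \<in> arcs Q \<Longrightarrow> reach v (tail Q a) \<Longrightarrow> R (tail Q a) \<Longrightarrow> R (head Q a)"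
  shows "R w"
  using assms(1)
proof (induction rule: rtrancl_induct)
  case (step w w')
  then show ?case using assms(3) by (auto simp: arc_rel_def)
qed (rule assms(2))

lemma space_thin_proj: "space (P v) w = (if reach v w then span {e} else {0})"
  by (simp add: thin_proj_def)

lemma arr_thin_proj: "arr (P v) a x = (if reach v (tail Q a) \<and> x \<in> span {e} then x else 0)"
  by (simp add: thin_proj_def)

lemma e_in_thin_proj: "reach v w \<Longrightarrow> e \<in> space (P v) w"
  by (simp add: space_thin_proj span_base)

lemma is_rep_thin_proj: "is_rep s Q (P v)"
proof -
  have "fd_subspace s (span {e})" by (intro fd_subspaceI[of _ "{e}"]) auto
  moreover have "fd_subspace s {0}" by (intro fd_subspaceI[of _ "{}"]) auto
  ultimately show ?thesis
    using reach_arc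
    by (auto simp: is_rep_def space_thin_proj arr_thin_proj lin_maps_def span_add span_scale span_zero)
qed

text \<open>
  The vector \<open>e\<close> at \<open>v\<close> generates: every arc that starts at a reachable vertex maps \<open>e\<close> to \<open>e\<close>, so
  the values of a morphism at \<open>e\<close> spread from \<open>v\<close> to all reachable vertices.
\<close>

lemma hom_thin_proj_eqI:
  assumes f: "f \<in> rep_hom s Q (P v) M" and g: "g \<in> rep_hom s Q (P v) M" and eq: "f v e = g v e"
  shows "f = g"
proof (rule rep_hom_eqI[OF f g])
  have e: "f w e = g w e" if "reach v w" for w
    using that
  proof (induction rule: reach_induct)
    case (arc a)
    then show ?case
      using rep_hom_arr[OF f, of a e] rep_hom_arr[OF g, of a e] e_in_thin_proj[of v "tail Q a"]
      by (simp add: arr_thin_proj span_base)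
  qed (rule eq)
  fix w x assume w: "w \<in> verts Q" and x: "x \<in> space (P v) w"
  show "f w x = g w x"
  proof (cases "reach v w")
    case True
    then obtain c where "x = s c e" using x by (auto simp: space_thin_proj span_singleton)
    then show ?thesis
      using e[OF True] lin_maps_scale[OF rep_hom_lin[OF f w] e_in_thin_proj[OF True]]
        lin_maps_scale[OF rep_hom_lin[OF g w] e_in_thin_proj[OF True]] by simp
  next
    case False
    then have "x = 0" using x by (simp add: space_thin_proj)
    then show ?thesis using rep_hom_zero[OF f] rep_hom_zero[OF g] by simp
  qed
qed

text \<open>
  The morphism maps \<open>e\<close> at \<open>w\<close> to the vector \<open>x w\<close> obtained by transporting \<open>m\<close> along the path
  from \<open>v\<close> to \<open>w\<close> with the maps of \<open>M\<close>.
\<close>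

lemma hom_thin_proj_exists:
  assumes M: "is_rep s Q M" and v: "v \<in> verts Q" and m: "m \<in> space M v"
  shows "\<exists>f\<in>rep_hom s Q (P v) M. f v e = m"
proof -
  obtain x where x: "x v = m" "\<And>a. a \<in> arcs Q \<Longrightarrow> reach v (tail Q a) \<Longrightarrow> x (head Q a) = arr M a (x (tail Q a))"
    using oriented_tree_propagate[OF tree v, of m "arr M"] by blast
  have x_mem: "x w \<in> space M w" if "reach v w" for w
    using that
  proof (induction rule: reach_induct)
    case (arc a)
    then show ?case using x(2) lin_maps_mem[OF is_rep_arr[OF M]] by simp
  qed (use x m in simp)
  define coord where "coord y = (SOME c. y = s c e)" for y
  have coord: "coord (s c e) = c" for c
    unfolding coord_def using e_nonzero by (intro some_equality) auto
  define f where "f w y = (if w \<in> verts Q \<and> reach v w \<and> y \<in> span {e} then s (coord y) (x w) else 0)" for w y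
  have f_e: "f w (s c e) = s c (x w)" if "w \<in> verts Q" "reach v w" for w c
    using that by (simp add: f_def coord span_scale span_base)
  have "f w \<in> lin_maps s s (space (P v) w) (space M w)" if w: "w \<in> verts Q" for w
  proof (cases "reach v w")
    case True
    have "f w y \<in> space M w" if "y \<in> span {e}" for y
      using that x_mem[OF True] subspace_scale[OF is_rep_subspace[OF M w]] f_e[OF w True]
      by (auto simp: span_singleton)
    moreover have "f w (y + z) = f w y + f w z" if "y \<in> span {e}" "z \<in> span {e}" for y z
      using that f_e[OF w True] by (auto simp: span_singleton simp flip: scale_left_distrib)
    moreover have "f w (s c y) = s c (f w y)" if "y \<in> span {e}" for c y
      using that f_e[OF w True] by (auto simp: span_singleton)
    ultimately show ?thesis
      using True by (simp add: lin_maps_def space_thin_proj) (simp add: f_def)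
  next
    case False
    then show ?thesis
      using subspace_0[OF is_rep_subspace[OF M w]] by (simp add: lin_maps_def space_thin_proj f_def)
  qed
  moreover have "f (head Q a) (arr (P v) a y) = arr M a (f (tail Q a) y)"
    if a: "a \<in> arcs Q" and y: "y \<in> space (P v) (tail Q a)" for a y
  proof (cases "reach v (tail Q a)")
    case True
    then obtain c where c: "y = s c e" using y by (auto simp: space_thin_proj span_singleton)
    have "f (head Q a) (arr (P v) a y) = s c (x (head Q a))"
      using True y f_e[of "head Q a" c] arc_ends[OF a] reach_arc[OF a True]
      by (simp add: arr_thin_proj space_thin_proj c)
    also have "\<dots> = arr M a (f (tail Q a) y)"
      using True x(2)[OF a] f_e[of "tail Q a" c] arc_ends[OF a] x_mem[OF True]
      by (simp add: c lin_maps_scale[OF is_rep_arr[OF M a]])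
    finally show ?thesis .
  next
    case False
    moreover have "f w 0 = 0" for w using coord[of 0] by (simp add: f_def)
    ultimately show ?thesis
      using y lin_maps_zero[OF is_rep_arr[OF M a]] by (simp add: arr_thin_proj space_thin_proj)
  qed
  ultimately have "f \<in> rep_hom s Q (P v) M"
    by (auto simp: rep_hom_def) (auto simp: f_def fun_eq_iff)
  moreover have "f v e = m" using f_e[of v 1] v x by simp
  ultimately show ?thesis by blast
qed

text \<open>
  The inverse of the evaluation \<open>Hom(P\<^sub>v, M) \<rightarrow> M\<^sub>v\<close> at \<open>e\<close>.
\<close>

definition yoneda_hom :: "('v, 'a, 'u) rep \<Rightarrow> 'v \<Rightarrow> 'u \<Rightarrow> ('v, 'u) rep_mor" where
  "yoneda_hom M v m = (SOME f. f \<in> rep_hom s Q (P v) M \<and> f v e = m)"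

lemma yoneda_hom:
  assumes "is_rep s Q M" "v \<in> verts Q" "m \<in> space M v"
  shows "yoneda_hom M v m \<in> rep_hom s Q (P v) M" "yoneda_hom M v m v e = m"
  using someI_ex[OF hom_thin_proj_exists[OF assms, unfolded Bex_def]] by (auto simp: yoneda_hom_def)

lemma yoneda_hom_eq:
  assumes "is_rep s Q M" "v \<in> verts Q" and f: "f \<in> rep_hom s Q (P v) M"
  shows "yoneda_hom M v (f v e) = f"
  using assms yoneda_hom[OF assms(1,2) rep_hom_mem[OF f assms(2) e_in_thin_proj]]
  by (auto intro: hom_thin_proj_eqI)

text \<open>
  Naturality of the identification of \<open>Hom(P\<^sub>v, M)\<close> with the space of \<open>M\<close> at \<open>v\<close>.
\<close>

lemma comp_yoneda_hom:
  assumes M: "is_rep s Q M" and N: "is_rep s Q N" and f: "f \<in> rep_hom s Q M N"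
    and v: "v \<in> verts Q" and m: "m \<in> space M v"
  shows "rep_comp f (yoneda_hom M v m) = yoneda_hom N v (f v m)"
  using yoneda_hom_eq[OF N v rep_comp_in_hom[OF yoneda_hom(1)[OF M v m] f]] yoneda_hom(2)[OF M v m]
  by (simp add: rep_comp_def)

text \<open>
  By the Yoneda identification, lifting a morphism along \<open>g\<close> amounts to choosing a preimage of one
  vector at \<open>v\<close>.
\<close>

lemma projective_thin_proj:
  assumes v: "v \<in> verts Q"
  shows "projective_rep s Q (P v)"
  unfolding projective_rep_def
proof (intro conjI is_rep_thin_proj allI impI ballI)
  fix M N g f
  assume M: "is_rep s Q M" and N: "is_rep s Q N" and g: "g \<in> rep_hom s Q M N"
    and f: "f \<in> rep_hom s Q (P v) N" and surj: "rep_surj Q M N g"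
  have "f v e \<in> g v ` space M v"
    using surj v rep_hom_mem[OF f v e_in_thin_proj] by (auto simp: rep_surj_def)
  then obtain m where m: "m \<in> space M v" "g v m = f v e" by auto
  have "rep_comp g (yoneda_hom M v m) = f"
    using comp_yoneda_hom[OF M N g v m(1)] yoneda_hom_eq[OF N v f] m(2) by simp
  then show "\<exists>h\<in>rep_hom s Q (P v) M. rep_comp g h = f"
    using yoneda_hom(1)[OF M v m(1)] by blast
qed

definition id_obj :: "'v \<Rightarrow> ('v, 'a, 'u) mono_obj" where
  "id_obj v = \<lparr>src = P v, tgt = P v, incl = rep_id Q (P v)\<rparr>"

text \<open>
  If \<open>(0, i)\<close> and \<open>(0, p)\<close> split a summand \<open>0 \<rightarrow> R\<close> off an identity, then commutativity of the square
  of \<open>(0, p)\<close> gives \<open>p = 0\<close>, and \<open>p \<circ> i = id\<close> forces \<open>R = 0\<close>.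
\<close>

lemma zero_summand_id_obj:
  assumes Y: "direct_summand (hom_mono s Q) Y (id_obj v)" and src: "zero_rep Q (src Y)"
  shows "zero_rep Q (tgt Y)"
proof -
  obtain i p where i: "i \<in> hom (hom_mono s Q) Y (id_obj v)" and p: "p \<in> hom (hom_mono s Q) (id_obj v) Y"
    and pi: "cmp (hom_mono s Q) p i = idt (hom_mono s Q) Y" and Y': "Y \<in> obj (hom_mono s Q)"
    using Y by (auto simp: direct_summand_def biproduct_def)
  have i2: "snd i \<in> rep_hom s Q (tgt Y) (P v)" and p1: "fst p \<in> rep_hom s Q (P v) (src Y)"
    and p2: "snd p \<in> rep_hom s Q (P v) (tgt Y)"
    and sq: "rep_comp (snd p) (rep_id Q (P v)) = rep_comp (incl Y) (fst p)"
    and inclY: "incl Y \<in> rep_hom s Q (src Y) (tgt Y)" and tgtY: "is_rep s Q (tgt Y)"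
    using i p Y' by (auto simp: hom_mono_def id_obj_def projective_rep_def)
  have split: "rep_comp (snd p) (snd i) = rep_id Q (tgt Y)"
    using pi by (auto simp: hom_mono_def split: prod.splits)
  have "y = 0" if w: "w \<in> verts Q" and y: "y \<in> space (tgt Y) w" for w y
  proof -
    have "y = snd p w (snd i w y)"
      using fun_cong[OF fun_cong[OF split, of w], of y] w y
      by (simp add: rep_comp_def rep_id_def id_map_def)
    also have "\<dots> = incl Y w (fst p w (snd i w y))"
      using sq unfolding rep_comp_id_right[OF p2] by (simp add: rep_comp_def)
    also have "fst p w (snd i w y) = 0"
      using rep_hom_mem[OF p1 w rep_hom_mem[OF i2 w y]] src w by (simp add: zero_rep_def)
    finally show ?thesis by (simp add: rep_hom_zero[OF inclY])
  qed
  then show ?thesis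
    using subspace_0[OF is_rep_subspace[OF tgtY]] by (auto simp: zero_rep_def)
qed

lemma id_obj_in_H_cat:
  assumes v: "v \<in> verts Q"
  shows "id_obj v \<in> obj (H_cat s Q)"
proof -
  have "id_obj v \<in> obj (hom_mono s Q)"
    using projective_thin_proj[OF v] rep_id_in_hom[OF is_rep_thin_proj]
    by (auto simp: hom_mono_def id_obj_def rep_inj_def rep_id_def id_map_def inj_on_def)
  then show ?thesis using zero_summand_id_obj by (auto simp: H_cat_def)
qed

lemma hat_obj_id_obj: "hat_obj s Q M (id_obj v) = rep_hom s Q (P v) M"
  using rep_comp_id_right[of _ s Q "P v" M] by (simp add: hat_obj_def id_obj_def)

lemma yoneda_hom_in_H_cat_hom:
  assumes X: "X \<in> obj (H_cat s Q)" and v: "v \<in> verts Q" and x: "x \<in> space (src X) v"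
  shows "(yoneda_hom (src X) v x, rep_comp (incl X) (yoneda_hom (src X) v x)) \<in> hom (H_cat s Q) (id_obj v) X"
proof -
  note \<rho> = yoneda_hom(1)[OF H_catD(1)[OF X] v x]
  show ?thesis
    using \<rho> rep_comp_in_hom[OF \<rho> H_catD(3)[OF X]]
    by (simp add: H_cat_def hom_mono_def id_obj_def rep_comp_id_right)
qed

section \<open>Full faithfulness\<close>

lemma faithful_Lambda:
  assumes M: "is_rep s Q M" and f: "f \<in> rep_hom s Q M N" and g: "g \<in> rep_hom s Q M N"
    and eq: "Lambda_mor s Q M N f = Lambda_mor s Q M N g"
  shows "f = g"
proof (rule rep_hom_eqI[OF f g])
  fix v m assume v: "v \<in> verts Q" and m: "m \<in> space M v"
  have "rep_comp f (yoneda_hom M v m) = rep_comp g (yoneda_hom M v m)"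
    using fun_cong[OF fun_cong[OF eq, of "id_obj v"], of "yoneda_hom M v m"] yoneda_hom(1)[OF M v m]
      id_obj_in_H_cat[OF v] by (simp add: Lambda_mor_def hat_obj_id_obj)
  then have "f v (yoneda_hom M v m v e) = g v (yoneda_hom M v m v e)"
    by (auto simp: rep_comp_def dest!: fun_cong[where x = v] fun_cong[where x = e])
  then show "f v m = g v m" using yoneda_hom(2)[OF M v m] by simp
qed

text \<open>
  The preimage \<open>f\<close> of \<open>\<eta>\<close> is read off from \<open>\<eta>\<close> at the identities of the thin projectives, through
  \<open>Hom(P\<^sub>v, M) = M\<^sub>v\<close>. Its compatibility with the arrows and the equality of \<open>\<eta>\<^sub>X(h)\<close> with \<open>f \<circ> h\<close> are
  both instances of the fact \<open>pointwise\<close> below.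
\<close>

lemma full_Lambda:
  assumes M: "is_rep s Q M" and N: "is_rep s Q N"
    and \<eta>: "\<eta> \<in> nat_trans (H_cat s Q) (rep_mor_scale s) (Lambda_obj s Q M) (Lambda_obj s Q N)"
  shows "\<exists>f\<in>rep_hom s Q M N. Lambda_mor s Q M N f = \<eta>"
proof -
  have lin: "\<eta> X \<in> lin_maps (rep_mor_scale s) (rep_mor_scale s) (hat_obj s Q M X) (hat_obj s Q N X)"
    if "X \<in> obj (H_cat s Q)" for X
    using \<eta> that by (simp add: nat_trans_def Lambda_fobj)
  have nat: "\<eta> X (rep_comp h (fst g)) = rep_comp (\<eta> Y h) (fst g)"
    if "X \<in> obj (H_cat s Q)" "Y \<in> obj (H_cat s Q)" "g \<in> hom (H_cat s Q) X Y" "h \<in> hat_obj s Q M Y"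
    for X Y g h
  proof -
    have "(\<eta> X \<circ> fmor (Lambda_obj s Q M) X Y g) h = (fmor (Lambda_obj s Q N) X Y g \<circ> \<eta> Y) h"
      using \<eta> that by (simp add: nat_trans_def)
    then show ?thesis using that lin_maps_mem[OF lin[OF that(2)] that(4)] by (simp add: Lambda_fmor)
  qed
  define f where "f v m = (if v \<in> verts Q \<and> m \<in> space M v then \<eta> (id_obj v) (yoneda_hom M v m) v e else 0)" for v m
  have hom: "\<eta> (id_obj v) (yoneda_hom M v m) \<in> rep_hom s Q (P v) N" if "v \<in> verts Q" "m \<in> space M v" for v m
    using lin_maps_mem[OF lin[OF id_obj_in_H_cat]] yoneda_hom(1)[OF M] that by (simp add: hat_obj_id_obj)
  have pointwise: "\<eta> X h v x = f v (h v x)"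
    if X: "X \<in> obj (H_cat s Q)" and h: "h \<in> hat_obj s Q M X" and v: "v \<in> verts Q"
      and x: "x \<in> space (src X) v" for X h v x
  proof -
    let ?\<rho> = "yoneda_hom (src X) v x"
    note hh = hat_obj_sub_hom[OF X h]
    \<comment> \<open>Naturality along \<open>(\<rho>, \<iota>\<rho>)\<close>, where \<open>\<rho>\<close> maps the generator \<open>e\<close> to \<open>x\<close>.\<close>
    have "\<eta> X h v x = rep_comp (\<eta> X h) ?\<rho> v e"
      using yoneda_hom(2)[OF H_catD(1)[OF X] v x] by (simp add: rep_comp_def)
    also have "\<dots> = \<eta> (id_obj v) (rep_comp h ?\<rho>) v e"
      using nat[OF id_obj_in_H_cat[OF v] X yoneda_hom_in_H_cat_hom[OF X v x] h] by simp
    also have "\<dots> = f v (h v x)"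
      using comp_yoneda_hom[OF H_catD(1)[OF X] M hh v x] rep_hom_mem[OF hh v x] v by (simp add: f_def)
    finally show ?thesis .
  qed
  have f_lin: "f v \<in> lin_maps s s (space M v) (space N v)" if v: "v \<in> verts Q" for v
  proof -
    note sub = is_rep_subspace[OF M v]
    note l = lin[OF id_obj_in_H_cat[OF v], unfolded hat_obj_id_obj]
    have "f v m \<in> space N v" if "m \<in> space M v" for m
      using rep_hom_mem[OF hom[OF v that] v e_in_thin_proj] that v by (simp add: f_def)
    moreover have "f v (m + m') = f v m + f v m'" if m: "m \<in> space M v" and m': "m' \<in> space M v" for m m'
    proof -
      have "yoneda_hom M v (m + m') = yoneda_hom M v m + yoneda_hom M v m'"
        using yoneda_hom_eq[OF M v mor.subspace_add[OF subspace_rep_hom[OF M] yoneda_hom(1)[OF M v m] yoneda_hom(1)[OF M v m']]]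
          yoneda_hom(2)[OF M v m] yoneda_hom(2)[OF M v m'] by simp
      then show ?thesis
        using v m m' subspace_add[OF sub m m'] lin_maps_add[OF l yoneda_hom(1)[OF M v m] yoneda_hom(1)[OF M v m']]
        by (simp add: f_def)
    qed
    moreover have "f v (s c m) = s c (f v m)" if m: "m \<in> space M v" for c m
    proof -
      have "yoneda_hom M v (s c m) = rep_mor_scale s c (yoneda_hom M v m)"
        using yoneda_hom_eq[OF M v mor.subspace_scale[OF subspace_rep_hom[OF M] yoneda_hom(1)[OF M v m]], of c]
          yoneda_hom(2)[OF M v m] by (simp add: rep_mor_scale_def)
      then show ?thesis
        using v m subspace_scale[OF sub m] lin_maps_scale[OF l yoneda_hom(1)[OF M v m]]
        by (simp add: f_def rep_mor_scale_def)
    qed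
    ultimately show ?thesis by (simp add: lin_maps_def) (simp add: f_def)
  qed
  have f_arr: "f (head Q a) (arr M a m) = arr N a (f (tail Q a) m)"
    if a: "a \<in> arcs Q" and m: "m \<in> space M (tail Q a)" for a m
  proof -
    let ?v = "tail Q a" and ?w = "head Q a"
    have v: "?v \<in> verts Q" and w: "?w \<in> verts Q" using arc_ends[OF a] by auto
    have r: "reach ?v ?w" using reach_arc[OF a] by simp
    have ev: "e \<in> space (P ?v) ?v" by (simp add: e_in_thin_proj)
    have arr_e: "arr (P ?v) a e = e" by (simp add: arr_thin_proj span_base)
    \<comment> \<open>The vector \<open>e\<close> at \<open>w\<close> is the image of the generator under the arrow, so \<open>pointwise\<close> applies to it.\<close>
    have "f ?w (arr M a m) = f ?w (yoneda_hom M ?v m ?w e)"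
      using rep_hom_arr[OF yoneda_hom(1)[OF M v m] a ev] yoneda_hom(2)[OF M v m] arr_e by simp
    also have "\<dots> = \<eta> (id_obj ?v) (yoneda_hom M ?v m) ?w e"
      using pointwise[OF id_obj_in_H_cat[OF v] _ w, of "yoneda_hom M ?v m" e] yoneda_hom(1)[OF M v m]
        e_in_thin_proj[OF r] by (simp add: hat_obj_id_obj) (simp add: id_obj_def)
    also have "\<dots> = arr N a (\<eta> (id_obj ?v) (yoneda_hom M ?v m) ?v e)"
      using rep_hom_arr[OF hom[OF v m] a ev] arr_e by simp
    finally show ?thesis using v m by (simp add: f_def)
  qed
  have f: "f \<in> rep_hom s Q M N"
    using f_lin f_arr by (auto simp: rep_hom_def) (auto simp: f_def fun_eq_iff)
  have "Lambda_mor s Q M N f X h = \<eta> X h" for X h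
  proof (cases "X \<in> obj (H_cat s Q) \<and> h \<in> hat_obj s Q M X")
    case True
    then have X: "X \<in> obj (H_cat s Q)" and h: "h \<in> hat_obj s Q M X" by auto
    have "rep_comp f h = \<eta> X h"
    proof (rule rep_hom_eqI)
      show "rep_comp f h \<in> rep_hom s Q (src X) N"
        by (rule rep_comp_in_hom[OF hat_obj_sub_hom[OF X h] f])
      show "\<eta> X h \<in> rep_hom s Q (src X) N"
        by (rule hat_obj_sub_hom[OF X lin_maps_mem[OF lin[OF X] h]])
    qed (simp add: pointwise[OF X h] rep_comp_def)
    then show ?thesis using True by (simp add: Lambda_mor_def)
  next
    case False
    have "\<eta> X h = 0"
    proof (cases "X \<in> obj (H_cat s Q)")
      case True
      then show ?thesis using False lin_maps_outside[OF lin] by blast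
    next
      case False
      then show ?thesis using \<eta> by (simp add: nat_trans_def)
    qed
    then show ?thesis using False by (auto simp: Lambda_mor_def)
  qed
  then show ?thesis using f by blast
qed

lemma fully_faithful_Lambda:
  "fully_faithful (mod_kQ s Q) (mod_Hop s Q) (Lambda_obj s Q) (Lambda_mor s Q)"
proof -
  have "bij_betw (Lambda_mor s Q M N) (rep_hom s Q M N)
      (nat_trans (H_cat s Q) (rep_mor_scale s) (Lambda_obj s Q M) (Lambda_obj s Q N))"
    if M: "is_rep s Q M" and N: "is_rep s Q N" for M N
    using faithful_Lambda[OF M] nat_trans_Lambda_mor[OF M N] full_Lambda[OF M N]
    by (intro bij_betw_imageI inj_onI) (auto simp: image_iff, metis)
  then show ?thesis
    by (simp add: fully_faithful_def mod_kQ_def mod_Hop_def cat_modules_def)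
qed

end

theorem corollary5p4:
  fixes s :: "'k::field \<Rightarrow> 'u::ab_group_add \<Rightarrow> 'u"
    and Q :: "('v, 'a) pre_digraph"
  assumes "vector_space s"
    and "\<not> fd_subspace s UNIV"
    and "dynkin_quiver Q"
  shows "is_functor (mod_kQ s Q) (mod_Hop s Q) (Lambda_obj s Q) (Lambda_mor s Q) \<and>
         fully_faithful (mod_kQ s Q) (mod_Hop s Q) (Lambda_obj s Q) (Lambda_mor s Q)"
proof -
  interpret vector_space s by fact
  note tree = dynkin_quiver_oriented_tree[OF assms(3)]
  \<comment> \<open>A zero universe would be finite dimensional.\<close>
  have "\<exists>e::'u. e \<noteq> 0"
  proof (rule ccontr)
    assume "\<nexists>e::'u. e \<noteq> 0"
    then have "(UNIV :: 'u set) \<subseteq> span {}" by auto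
    then show False using fd_subspaceI[of UNIV "{}"] assms(2) by simp
  qed
  then obtain e :: 'u where "e \<noteq> 0" by blast
  then interpret tree_quiver_reps s Q e
    using assms(3) tree oriented_tree_finite[OF tree]
    by unfold_locales (auto simp: dynkin_quiver_def wf_digraph_def)
  show ?thesis using is_functor_Lambda fully_faithful_Lambda by blast
qed

end
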